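(* Let $X=Y=\mathbb R^n$ and let $\mu,\nu\in\mathcal P(\mathbb R^n)$ be probability measures with finite second moment which are strongly $p$-compatible, where $p(x,y)=-\ln(\langle x,y\rangle-1)_+$ is the polar cost, that is, $$\mu(K)+\nu(K^\circ)<1$$ for any convex set $K$ with $\mu(K)\ne 0,1$. Assume further that $\mu$ is absolutely continuous, and that there exists some finite cost plan mapping $\mu$ to $\nu$. Then there exists $\varphi\in\mathrm{Cvx}_0(\mathbb R^n)$ such that $\partial^\circ\varphi$ is an optimal transport map between $\mu$ and $\nu$, where $$\partial^\circ\varphi(x)=\{y\in\mathbb R^n:\ \varphi(x)\,\mathcal A\varphi(y)=\langle x,y\rangle-1>0\}.$$ In particular, for $\mu$-almost every $x$, the set $\partial^\circ\varphi(x)$ is a singleton.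
   Context: The polar cost is $p(x,y)=-\ln(\langle x,y\rangle-1)$ if $\langle x,y\rangle>1$ and $p(x,y)=+\infty$ otherwise. $K^\circ=\{y\in\mathbb R^n:\ \langle x,y\rangle\le 1\ \forall x\in K\}$ is the polar set. $\mathrm{Cvx}_0(\mathbb R^n)$ is the class of lower semi-continuous convex functions $\varphi:\mathbb R^n\to[0,\infty]$ with $\varphi(0)=0$. The polarity transform is $$\mathcal A\varphi(y)=\sup_{\{x:\ \langle x,y\rangle>1\}}\frac{\langle x,y\rangle-1}{\varphi(x)}$$ (a quotient with positive numerator is $+\infty$ when $\varphi(x)=0$ and $0$ when $\varphi(x)=\infty$; the supremum of the empty set is $0$). By definition $\partial^\circ\varphi(x)=\emptyset$ if $\varphi(x)\in\{0,\infty\}$. A transport plan between $\mu$ and $\nu$ is a probability measure $\pi$ on $\mathbb R^n\times\mathbb R^n$ with marginals $\mu$, $\nu$; it is a finite cost plan if $\int p\,d\pi<+\infty$, and optimal if it minimizes $\int p\,d\pi$ among all plans. A transport map is a measurable $T$ with $\nu(B)=\mu(T^{-1}(B))$ for all measurable $B$. That $\partial^\circ\varphi$ is an optimal transport map means: for $\mu$-a.e. $x$ the set $\partial^\circ\varphi(x)$ is a single point $T(x)$, $T$ transports $\mu$ to $\nu$, and the plan induced by $T$ (supported on its graph) is an optimal plan. *)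

theory Defs
  imports "HOL-Probability.Probability"
begin

definition polar_cost :: "'a::euclidean_space \<Rightarrow> 'a \<Rightarrow> ereal" where
  "polar_cost x y = (if x \<bullet> y > 1 then ereal (- ln (x \<bullet> y - 1)) else \<infinity>)"

definition polar_set :: "'a::euclidean_space set \<Rightarrow> 'a set" where
  "polar_set K = {y. \<forall>x\<in>K. x \<bullet> y \<le> 1}"

text \<open>A convex set need not be Borel, so its measure is taken in the completion. If the measure is
  absolutely continuous, every convex set is measurable there, since its frontier is a null set.
  The polar set is closed.\<close>

definition strongly_polar_compatible :: "'a::euclidean_space measure \<Rightarrow> 'a measure \<Rightarrow> bool" where
  "strongly_polar_compatible \<mu> \<nu> \<longleftrightarrow>
     (\<forall>K. convex K \<longrightarrow> measure (completion \<mu>) K \<noteq> 0 \<longrightarrow> measure (completion \<mu>) K \<noteq> 1 \<longrightarrow>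
        measure (completion \<mu>) K + measure \<nu> (polar_set K) < 1)"

definition borel_prob :: "'a::euclidean_space measure \<Rightarrow> bool" where
  "borel_prob \<mu> \<longleftrightarrow> sets \<mu> = sets borel \<and> prob_space \<mu>"

definition finite_second_moment :: "'a::euclidean_space measure \<Rightarrow> bool" where
  "finite_second_moment \<mu> \<longleftrightarrow> integrable \<mu> (\<lambda>x. (norm x)\<^sup>2)"

definition transport_plan ::
    "'a::euclidean_space measure \<Rightarrow> 'a measure \<Rightarrow> ('a \<times> 'a) measure \<Rightarrow> bool" where
  "transport_plan \<mu> \<nu> \<pi> \<longleftrightarrow> borel_prob \<pi> \<and> distr \<pi> borel fst = \<mu> \<and> distr \<pi> borel snd = \<nu>"

text \<open>The integral of the positive part minus that of the negative part (\<^const>\<open>e2ennreal\<close> sends negative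
  arguments to 0). For the polar cost and marginals with finite second moments the latter is finite,
  because the negative part of the cost is at most \<open>\<bar>x \<bullet> y\<bar>\<close>; so \<open>\<infinity> - \<infinity>\<close> does not occur.\<close>

definition extended_integral :: "'b measure \<Rightarrow> ('b \<Rightarrow> ereal) \<Rightarrow> ereal" where
  "extended_integral M f =
     enn2ereal (\<integral>\<^sup>+ z. e2ennreal (f z) \<partial>M) - enn2ereal (\<integral>\<^sup>+ z. e2ennreal (- f z) \<partial>M)"

definition plan_cost :: "('a::euclidean_space \<times> 'a) measure \<Rightarrow> ereal" where
  "plan_cost \<pi> = extended_integral \<pi> (\<lambda>(x, y). polar_cost x y)"

definition finite_cost_plan ::
    "'a::euclidean_space measure \<Rightarrow> 'a measure \<Rightarrow> ('a \<times> 'a) measure \<Rightarrow> bool" where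
  "finite_cost_plan \<mu> \<nu> \<pi> \<longleftrightarrow> transport_plan \<mu> \<nu> \<pi> \<and> plan_cost \<pi> < \<infinity>"

definition optimal_plan ::
    "'a::euclidean_space measure \<Rightarrow> 'a measure \<Rightarrow> ('a \<times> 'a) measure \<Rightarrow> bool" where
  "optimal_plan \<mu> \<nu> \<pi> \<longleftrightarrow>
     transport_plan \<mu> \<nu> \<pi> \<and> (\<forall>\<pi>'. transport_plan \<mu> \<nu> \<pi>' \<longrightarrow> plan_cost \<pi> \<le> plan_cost \<pi>')"

definition transport_map ::
    "'a::euclidean_space measure \<Rightarrow> 'a measure \<Rightarrow> ('a \<Rightarrow> 'a) \<Rightarrow> bool" where
  "transport_map \<mu> \<nu> T \<longleftrightarrow> T \<in> borel_measurable \<mu> \<and> distr \<mu> borel T = \<nu>"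

definition optimal_transport_map ::
    "'a::euclidean_space measure \<Rightarrow> 'a measure \<Rightarrow> ('a \<Rightarrow> 'a set) \<Rightarrow> bool" where
  "optimal_transport_map \<mu> \<nu> S \<longleftrightarrow>
     (\<exists>T. transport_map \<mu> \<nu> T \<and> (AE x in \<mu>. S x = {T x}) \<and>
          optimal_plan \<mu> \<nu> (distr \<mu> borel (\<lambda>x. (x, T x))))"

text \<open>In \<^typ>\<open>ennreal\<close>, \<open>0 * \<infinity> = 0\<close>, so the convexity inequality is harmless at the end points
  of the segment.\<close>

definition Cvx0 :: "('a::euclidean_space \<Rightarrow> ennreal) set" where
  "Cvx0 = {\<phi>. (\<forall>x. \<phi> x \<le> Liminf (at x) \<phi>) \<and>
     (\<forall>x y u v. 0 \<le> u \<longrightarrow> 0 \<le> v \<longrightarrow> u + v = 1 \<longrightarrow>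
        \<phi> (u *\<^sub>R x + v *\<^sub>R y) \<le> ennreal u * \<phi> x + ennreal v * \<phi> y) \<and>
     \<phi> 0 = 0}"

text \<open>Division in \<^typ>\<open>ennreal\<close> satisfies \<open>a / 0 = \<infinity>\<close> for \<open>a > 0\<close> and \<open>a / \<infinity> = 0\<close> for finite \<open>a\<close>,
  and the supremum of the empty set is \<open>0\<close>.\<close>

definition polarity_transform :: "('a::euclidean_space \<Rightarrow> ennreal) \<Rightarrow> 'a \<Rightarrow> ennreal" where
  "polarity_transform \<phi> y = (SUP x\<in>{x. x \<bullet> y > 1}. ennreal (x \<bullet> y - 1) / \<phi> x)"

definition polar_subdifferential :: "('a::euclidean_space \<Rightarrow> ennreal) \<Rightarrow> 'a \<Rightarrow> 'a set" where
  "polar_subdifferential \<phi> x =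
     (if \<phi> x = 0 \<or> \<phi> x = \<infinity> then {}
      else {y. \<phi> x * polarity_transform \<phi> y = ennreal (x \<bullet> y - 1) \<and> x \<bullet> y - 1 > 0})"

end

theory Submission
  imports Defs
begin

text \<open>
  An optimal plan exists because plans with fixed marginals are weakly compact and the polar cost,
  once the quadratic \<open>(|x|^2 + |y|^2) / 2\<close> is added to it, is nonnegative and
  continuous with values in \<open>[0, \<infinity>]\<close>. The added term has the same integral
  for all plans, so nothing changes for the minimisation (\<open>plan_cost_shift\<close>,
  \<open>exists_minimal_plan\<close>). The compactness theorem of Prokhorov on a Euclidean space is
  obtained from Helly's theorem on the line: a space-filling curve with a measurable section carries
  tight sequences on the space to tight sequences on the line, and weak limits on the line back to
  weak limits on the space (\<open>prokhorov_euclidean\<close>).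

  Let \<open>\<pi>\<close> be an optimal plan, which has finite cost, and \<open>\<Gamma>\<close>
  the part of its support where the cost is finite. Permuting the first components within finite
  samples of \<open>\<pi>\<close> cannot lower the cost, so \<open>\<Gamma>\<close> is cyclically
  monotone (\<open>cyclical_monotonicity\<close>). For a cost that is infinite at some pairs this
  does not suffice for a potential: the construction of Rockafellar takes a supremum over all paths
  from a base point, and the supremum may be infinite. It is finite if every two points of
  \<open>\<Gamma>\<close> are joined by a path, since a path back closes every path to a cycle, and
  the gain along a cycle is bounded. This is where strong compatibility enters. If \<open>R\<close>
  is the set of points that can be reached from a given one and \<open>K\<close> is the polar of the
  second components of \<open>R\<close>, then the first component of a point of
  \<open>\<Gamma>\<close> lies in \<open>K\<close> exactly if the point is not in \<open>R\<close>,
  whereas the second components of \<open>R\<close> lie in its polar \<open>K*\<close>. Hence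
  \<open>\<mu>(K) + \<nu>(K*) \<ge> 1\<close>, so \<open>\<mu>(K)\<close> is 0 or 1, and
  \<open>R\<close> has full measure because it contains a neighbourhood of its base point in the
  support; it therefore meets the set of points from which another given point can be reached in one
  step, which is not null either (\<open>paths_connect_support\<close>).

  Written multiplicatively, the potential is a supremum of functions \<open>x \<mapsto> c * max 0
  (\<langle>x, y\<rangle> - 1)\<close>, hence lies in the class \<open>Cvx0\<close>; writing
  \<open>S\<close> for its polar subdifferential, every pair \<open>(x, y)\<close> in
  \<open>\<Gamma>\<close> satisfies \<open>y \<in> S(x)\<close>
  (\<open>potential_polar_subdifferential\<close>). On the other hand \<open>y \<in> S(x)\<close>
  says that \<open>\<phi>(x) y / (\<langle>x, y\<rangle> - 1)\<close> is a subgradient of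
  \<open>\<phi>\<close> at \<open>x\<close>, and this vector determines \<open>y\<close>. A finite
  convex function on an open set has only one subgradient at almost every point, so
  \<open>S(x)\<close> has at most one element for \<open>\<mu>\<close>-almost every \<open>x\<close>
  (\<open>AE_polar_subdifferential_unique\<close>). Therefore \<open>\<pi>\<close> is carried by the
  graph of a map, which is measurable because \<open>\<Gamma>\<close> is a countable union of
  compact sets, and the plan that this map induces is \<open>\<pi>\<close> itself.
\<close>

section \<open>A space-filling curve with a measurable section\<close>

text \<open>The profile of Schoenberg's space-filling curve: 2-periodic, equal to 0 on \<open>[0,
  1/3]\<close> and to 1 on \<open>[2/3, 1]\<close>. The truncated cosine makes continuity and
  periodicity immediate.\<close>

definition bump :: "real \<Rightarrow> real" where
  "bump t = max 0 (min 1 (1/2 - cos (pi * t)))"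

lemma bump_bounds: "0 \<le> bump t" "bump t \<le> 1"
  by (auto simp: bump_def)

lemma continuous_bump: "continuous_on A bump"
  unfolding bump_def by (intro continuous_intros)

lemma cos_pi_add_even:
  fixes m :: nat
  shows "cos (pi * (2 * real m + u)) = cos (pi * u)"
proof -
  have "pi * (2 * real m + u) = pi * u + real m * (2 * pi)" by (simp add: algebra_simps)
  moreover have "cos (pi * u + real m * (2 * pi)) = cos (pi * u)"
    using cos.plus_of_nat[of "pi * u" m] by simp
  ultimately show ?thesis by simp
qed

lemma bump_add_even: "bump (2 * real m + u) = bump u"
  by (simp add: bump_def cos_pi_add_even)

lemma bump_eq_0: assumes "0 \<le> u" "u \<le> 1/3" shows "bump u = 0"
proof -
  have "cos (pi/3) \<le> cos (pi * u)"
    using assms by (intro cos_monotone_0_pi_le) (auto simp: mult_left_le)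
  then show ?thesis by (simp add: bump_def cos_60)
qed

lemma bump_eq_1: assumes "2/3 \<le> u" "u \<le> 1" shows "bump u = 1"
proof -
  have "cos (pi * u) \<le> cos (pi - pi/3)"
    using assms by (intro cos_monotone_0_pi_le) (auto simp: algebra_simps)
  also have "\<dots> = - (1/2)" by (simp only: cos_pi_minus cos_60)
  finally show ?thesis by (simp add: bump_def)
qed

text \<open>For a sequence of digits 0 and 1 this is the point of the ternary Cantor set with ternary digits
  \<open>2 * a i\<close>.\<close>

definition cantor_point :: "(nat \<Rightarrow> real) \<Rightarrow> real" where
  "cantor_point a = (\<Sum>i. 2 * a i / 3 ^ Suc i)"

context
  fixes a :: "nat \<Rightarrow> real"
  assumes a: "\<And>i. a i \<in> {0, 1}"
begin

lemma summable_cantor: "summable (\<lambda>i. 2 * a i / 3 ^ Suc i)"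
proof (rule summable_comparison_test'[where N=0])
  show "summable (\<lambda>i. 2 / 3 * (1/3::real) ^ i)"
    by (intro summable_mult summable_geometric) auto
  show "norm (2 * a n / 3 ^ Suc n) \<le> 2 / 3 * (1/3) ^ n" for n
    using a[of n] by (auto simp: power_divide)
qed

lemma cantor_point_bounds: "0 \<le> cantor_point a" "cantor_point a \<le> 1"
proof -
  show "0 \<le> cantor_point a"
    unfolding cantor_point_def using a by (intro suminf_nonneg summable_cantor) (metis divide_nonneg_pos insertE mult_nonneg_nonneg order.refl singletonD zero_le_numeral zero_le_one zero_less_numeral zero_less_power)
  have "(\<lambda>i. 2 / 3 * (1/3::real) ^ i) sums (2 / 3 * (1 / (1 - 1/3)))"
    by (intro sums_mult geometric_sums) auto
  then have s: "(\<lambda>i. 2 / 3 * (1/3::real) ^ i) sums 1" by simp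
  have "cantor_point a \<le> (\<Sum>i. 2 / 3 * (1/3::real) ^ i)"
    unfolding cantor_point_def
  proof (intro suminf_le summable_cantor)
    show "2 * a n / 3 ^ Suc n \<le> 2 / 3 * (1/3) ^ n" for n
      using a[of n] by (auto simp: power_divide)
    show "summable (\<lambda>i. 2 / 3 * (1/3::real) ^ i)" using s by (rule sums_summable)
  qed
  then show "cantor_point a \<le> 1" using s by (simp add: sums_unique[symmetric])
qed

text \<open>Multiplication by 3 shifts the digits, up to the even integer \<open>2 * a 0\<close>, which the
  period of \<open>bump\<close> absorbs.\<close>

lemma cantor_point_shift: "3 * cantor_point a = 2 * a 0 + cantor_point (\<lambda>i. a (Suc i))"
proof -
  have "cantor_point a = 2 * a 0 / 3 + (\<Sum>i. 2 * a (Suc i) / 3 ^ Suc (Suc i))"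
    unfolding cantor_point_def using suminf_split_head[OF summable_cantor] by simp
  also have "(\<Sum>i. 2 * a (Suc i) / 3 ^ Suc (Suc i)) = (\<Sum>i. (2 * a (Suc i) / 3 ^ Suc i) / 3)"
    by (simp add: field_simps)
  also have "\<dots> = cantor_point (\<lambda>i. a (Suc i)) / 3"
    unfolding cantor_point_def
    using summable_cantor[unfolded summable_Suc_iff[symmetric, of "\<lambda>i. 2 * a i / 3 ^ Suc i"]]
    by (intro suminf_divide) (use summable_mult[of "\<lambda>i. 2 * a (Suc i) / 3 ^ Suc (Suc i)" 3] in \<open>simp add: field_simps\<close>)
  finally show ?thesis by simp
qed

end

text \<open>So a continuous function of \<open>t\<close> reads off any given digit of a Cantor point
  \<open>t\<close>: if \<open>a 0 = 0\<close> the point lies in \<open>[0, 1/3]\<close>,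
  otherwise in \<open>[2/3, 1]\<close>, and further digits follow by shifting.\<close>

lemma bump_cantor_point:
  assumes "\<And>i. a i \<in> {0, 1}"
  shows "bump (3 ^ k * cantor_point a) = a k"
  using assms
proof (induction k arbitrary: a)
  case 0
  let ?r = "cantor_point (\<lambda>i. a (Suc i))"
  have "0 \<le> ?r" "?r \<le> 1" using cantor_point_bounds[of "\<lambda>i. a (Suc i)"] 0 by auto
  moreover have "3 * cantor_point a = 2 * a 0 + ?r" using 0 by (rule cantor_point_shift)
  moreover have "a 0 = 0 \<or> a 0 = 1" using 0[of 0] by auto
  ultimately show ?case
    using bump_eq_0[of "cantor_point a"] bump_eq_1[of "cantor_point a"] by auto
next
  case (Suc k)
  let ?r = "cantor_point (\<lambda>i. a (Suc i))"
  obtain m :: nat where m: "a 0 = real m" using Suc.prems[of 0] by (metis insertE of_nat_0 of_nat_1 singletonD)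
  have "3 ^ Suc k * cantor_point a = 3 ^ k * (3 * cantor_point a)" by simp
  also have "\<dots> = 2 * real (3 ^ k * m) + 3 ^ k * ?r"
    by (subst cantor_point_shift) (use Suc.prems in \<open>auto simp: m algebra_simps\<close>)
  finally show ?case using Suc.IH[of "\<lambda>i. a (Suc i)"] Suc.prems by (simp only: bump_add_even)
qed

definition bin_digit :: "real \<Rightarrow> nat \<Rightarrow> real" where
  "bin_digit z k = of_int (\<lfloor>2 ^ Suc k * z\<rfloor> - 2 * \<lfloor>2 ^ k * z\<rfloor>)"

lemma bin_digit_01: "bin_digit z k \<in> {0, 1}"
proof -
  have "\<lfloor>2 ^ Suc k * z\<rfloor> - 2 * \<lfloor>2 ^ k * z\<rfloor> \<in> {0, 1}"
  proof -
    define w where "w = 2 ^ k * z"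
    have "2 ^ Suc k * z = 2 * w" by (simp add: w_def)
    moreover have "\<lfloor>2 * w\<rfloor> - 2 * \<lfloor>w\<rfloor> = 0 \<or> \<lfloor>2 * w\<rfloor> - 2 * \<lfloor>w\<rfloor> = 1" by linarith
    ultimately show ?thesis by (auto simp del: power_Suc simp flip: w_def)
  qed
  then show ?thesis unfolding bin_digit_def by auto
qed

text \<open>The partial sums telescope to \<open>\<lfloor>2 ^ k * z\<rfloor> / 2 ^ k\<close>.\<close>

lemma bin_digit_sums:
  assumes "0 \<le> z" "z < 1"
  shows "(\<lambda>k. bin_digit z k / 2 ^ Suc k) sums z"
proof -
  have "(\<lambda>k. of_int \<lfloor>2 ^ k * z\<rfloor> / (2::real) ^ k) \<longlonglongrightarrow> z"
  proof (rule real_tendsto_sandwich[where f="\<lambda>k. z - (1/2)^k" and h="\<lambda>k. z"])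
    have "2 ^ k * z - 1 \<le> of_int \<lfloor>2 ^ k * z\<rfloor>" for k by linarith
    then have "(2 ^ k * z - 1) / 2 ^ k \<le> of_int \<lfloor>2 ^ k * z\<rfloor> / 2 ^ k" for k
      by (intro divide_right_mono) auto
    then show "\<forall>\<^sub>F k in sequentially. z - (1/2)^k \<le> of_int \<lfloor>2 ^ k * z\<rfloor> / 2 ^ k"
      by (simp add: diff_divide_distrib power_divide)
    have "of_int \<lfloor>2 ^ k * z\<rfloor> / 2 ^ k \<le> (2 ^ k * z) / 2 ^ k" for k
      by (intro divide_right_mono) auto
    then show "\<forall>\<^sub>F k in sequentially. of_int \<lfloor>2 ^ k * z\<rfloor> / 2 ^ k \<le> z" by simp
    have "(\<lambda>k. z - (1/2)^k) \<longlonglongrightarrow> z - 0" by (intro tendsto_intros LIMSEQ_power_zero) auto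
    then show "(\<lambda>k. z - (1/2)^k) \<longlonglongrightarrow> z" by simp
  qed auto
  from telescope_sums[OF this] have
    "(\<lambda>k. of_int \<lfloor>2 ^ Suc k * z\<rfloor> / (2::real) ^ Suc k - of_int \<lfloor>2 ^ k * z\<rfloor> / (2::real) ^ k) sums (z - of_int \<lfloor>z\<rfloor>)"
    by simp
  moreover have "\<lfloor>z\<rfloor> = 0" using assms by linarith
  ultimately show ?thesis by (simp add: bin_digit_def field_simps)
qed

text \<open>The binary digits of all coordinates are stored in one digit sequence; this is the place of
  digit \<open>k\<close> of the coordinate along \<open>b\<close>.\<close>

definition digit_index :: "'a::euclidean_space \<Rightarrow> nat \<Rightarrow> nat" where
  "digit_index b k = prod_encode (to_nat_on Basis b, k)"

definition curve_coord :: "'a::euclidean_space \<Rightarrow> real \<Rightarrow> real" where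
  "curve_coord b t = (\<Sum>k. bump (3 ^ digit_index b k * t) / 2 ^ Suc k)"

text \<open>A continuous function that is constantly \<open>m\<close> on \<open>[2 * m, 2 * m + 1]\<close>:
  the part of \<open>t\<close> beyond the even integer is subtracted there. It lets a curve on
  the line reach all of the unbounded space.\<close>

definition curve_scale :: "real \<Rightarrow> real" where
  "curve_scale t = (t - arccos (cos (pi * t)) / pi) / 2"

text \<open>For \<open>t\<close> in \<open>[2 * m, 2 * m + 1]\<close> the curve runs through the cube of
  half side \<open>m\<close>.\<close>

definition space_curve :: "real \<Rightarrow> 'a::euclidean_space" where
  "space_curve t = curve_scale t *\<^sub>R (\<Sum>b\<in>Basis. (2 * curve_coord b t - 1) *\<^sub>R b)"

lemma continuous_space_curve: "continuous_on UNIV (space_curve :: real \<Rightarrow> 'a::euclidean_space)"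
proof -
  have "continuous_on UNIV (curve_coord b)" for b :: 'a
  proof -
    have "uniform_limit UNIV (\<lambda>n t. \<Sum>k<n. bump (3 ^ digit_index b k * t) / 2 ^ Suc k) (\<lambda>t. \<Sum>k. bump (3 ^ digit_index b k * t) / 2 ^ Suc k) sequentially"
    proof (rule Weierstrass_m_test)
      show "norm (bump (3 ^ digit_index b n * t) / 2 ^ Suc n) \<le> (1/2) ^ n" for n t
        using bump_bounds[of "3 ^ digit_index b n * t"] by (auto simp: field_simps)
      show "summable (\<lambda>n. (1/2::real) ^ n)" by (intro summable_geometric) auto
    qed
    then show ?thesis unfolding curve_coord_def[abs_def]
      by (rule uniform_limit_theorem[rotated]) 
         (auto intro!: always_eventually continuous_intros continuous_on_compose2[OF continuous_bump[of UNIV]])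
  qed
  moreover have "continuous_on UNIV curve_scale"
    unfolding curve_scale_def by (intro continuous_intros) auto
  ultimately show ?thesis unfolding space_curve_def by (intro continuous_intros) auto
qed

definition box_size :: "'a::euclidean_space \<Rightarrow> nat" where
  "box_size x = nat \<lfloor>norm x\<rfloor> + 1"

definition curve_digit :: "'a::euclidean_space \<Rightarrow> nat \<Rightarrow> real" where
  "curve_digit x i = (case prod_decode i of (j, k) \<Rightarrow>
     bin_digit ((x \<bullet> from_nat_into Basis j / box_size x + 1) / 2) k)"

text \<open>A cube containing \<open>x\<close> is chosen through the even part of the parameter, and the
  Cantor point stores the binary digits of the coordinates of \<open>x\<close> rescaled from
  that cube to \<open>[0, 1]\<close>.\<close>

definition curve_section :: "'a::euclidean_space \<Rightarrow> real" where
  "curve_section x = 2 * box_size x + cantor_point (curve_digit x)"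

lemma curve_digit_01: "curve_digit x i \<in> {0, 1}"
  unfolding curve_digit_def by (cases "prod_decode i") (auto simp del: insert_iff simp: bin_digit_01)

lemma space_curve_section: "space_curve (curve_section x) = x"
proof -
  let ?u = "cantor_point (curve_digit x)" and ?m = "box_size x"
  have u: "0 \<le> ?u" "?u \<le> 1" using cantor_point_bounds[of "curve_digit x"] curve_digit_01 by auto
  have "arccos (cos (pi * ?u)) = pi * ?u" using u by (intro arccos_cos) (auto simp: mult_left_le)
  then have scale: "curve_scale (curve_section x) = ?m"
    by (simp add: curve_scale_def curve_section_def cos_pi_add_even)
  have coord: "curve_coord b (curve_section x) = (x \<bullet> b / ?m + 1) / 2" if b: "b \<in> Basis" for b
  proof -
    let ?z = "(x \<bullet> b / ?m + 1) / 2"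
    have "bump (3 ^ digit_index b k * curve_section x) = bin_digit ?z k" for k
    proof -
      have "3 ^ digit_index b k * curve_section x = 2 * real (3 ^ digit_index b k * ?m) + 3 ^ digit_index b k * ?u"
        by (simp add: curve_section_def algebra_simps)
      then have "bump (3 ^ digit_index b k * curve_section x) = curve_digit x (digit_index b k)"
        by (simp only: bump_add_even bump_cantor_point[OF curve_digit_01])
      then show ?thesis
        using b by (simp add: curve_digit_def digit_index_def countable_finite)
    qed
    moreover have "\<bar>x \<bullet> b\<bar> < ?m"
      using Basis_le_norm[OF b, of x] unfolding box_size_def by linarith
    then have "0 \<le> ?z" "?z < 1" by (auto simp: field_simps abs_less_iff)
    ultimately show ?thesis unfolding curve_coord_def using bin_digit_sums[of ?z] by (simp add: sums_iff)
  qed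
  have "?m > 0" by (simp add: box_size_def)
  have "space_curve (curve_section x) = (\<Sum>b\<in>Basis. (?m * (2 * curve_coord b (curve_section x) - 1)) *\<^sub>R b)"
    by (simp add: space_curve_def scale scaleR_sum_right)
  also have "\<dots> = (\<Sum>b\<in>Basis. (x \<bullet> b) *\<^sub>R b)"
    using \<open>?m > 0\<close> by (intro sum.cong) (auto simp: coord field_simps)
  finally show ?thesis by (simp add: euclidean_representation)
qed

lemma curve_section_bounds: "0 \<le> curve_section x" "curve_section x \<le> 2 * norm x + 3"
proof -
  have "real (box_size x) \<le> norm x + 1" unfolding box_size_def by (simp add: of_nat_nat)
  then show "0 \<le> curve_section x" "curve_section x \<le> 2 * norm x + 3"
    using cantor_point_bounds[of "curve_digit x"] curve_digit_01[of x] by (auto simp: curve_section_def)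
qed

lemma measurable_curve_section: "curve_section \<in> borel_measurable borel"
proof -
  have [measurable]: "(box_size :: 'a \<Rightarrow> nat) \<in> borel \<rightarrow>\<^sub>M count_space UNIV"
    unfolding box_size_def by measurable
  have [measurable]: "(\<lambda>x::'a. curve_digit x i) \<in> borel_measurable borel" for i
    unfolding curve_digit_def bin_digit_def by (cases "prod_decode i") simp
  show ?thesis unfolding curve_section_def cantor_point_def by (intro borel_measurable_add borel_measurable_suminf) measurable
qed

section \<open>Weak compactness of transport plans\<close>

lemma borel_probD:
  assumes "borel_prob M"
  shows "prob_space M" "sets M = sets borel" "space M = UNIV"
  using assms sets_eq_imp_space_eq[of M borel] by (auto simp: borel_prob_def)

text \<open>The measures are moved to the line by the section of the space-filling curve, where Helly's
  theorem gives a weak limit, and the limit is moved back by the curve. Weak convergence passes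
  through the curve because it is continuous, and tightness through the section because that
  sends bounded sets to bounded sets.\<close>

theorem prokhorov_euclidean:
  fixes P :: "nat \<Rightarrow> 'a::euclidean_space measure"
  assumes P: "\<And>k. borel_prob (P k)"
    and tight: "\<And>e. e > 0 \<Longrightarrow> \<exists>R. \<forall>k. measure (P k) {x. norm x \<le> R} > 1 - e"
  obtains r Q where "strict_mono (r :: nat \<Rightarrow> nat)" "borel_prob Q"
    "\<And>f :: 'a \<Rightarrow> real. continuous_on UNIV f \<Longrightarrow> bounded (range f) \<Longrightarrow>
       (\<lambda>k. integral\<^sup>L (P (r k)) f) \<longlonglongrightarrow> integral\<^sup>L Q f"
proof -
  note [measurable_cong] = borel_probD(2)[OF P]
  note [simp] = borel_probD(3)[OF P]
  note [measurable] = measurable_curve_section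
  have [measurable]: "(space_curve :: real \<Rightarrow> 'a) \<in> borel_measurable borel"
    by (rule borel_measurable_continuous_onI[OF continuous_space_curve])
  define m where "m k = distr (P k) borel curve_section" for k
  have m: "real_distribution (m k)" for k
  proof -
    interpret prob_space "P k" by (rule borel_probD(1)[OF P])
    show ?thesis unfolding m_def by (rule real_distribution_distr) simp
  qed
  have "tight m"
    unfolding tight_def
  proof (intro conjI allI impI m)
    fix e :: real assume "e > 0"
    then obtain R where R: "\<And>k. measure (P k) {x. norm x \<le> R} > 1 - e" using tight by blast
    have "measure (m k) {-1<..2 * \<bar>R\<bar> + 3} > 1 - e" for k
    proof -
      interpret prob_space "P k" by (rule borel_probD(1)[OF P])
      have "measure (P k) {x. norm x \<le> R} \<le> measure (P k) (curve_section -` {-1<..2 * \<bar>R\<bar> + 3} \<inter> space (P k))"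
      proof (rule finite_measure_mono)
        show "{x. norm x \<le> R} \<subseteq> curve_section -` {-1<..2 * \<bar>R\<bar> + 3} \<inter> space (P k)"
        proof clarsimp
          fix x :: 'a assume "norm x \<le> R"
          with curve_section_bounds[of x] show "- 1 < curve_section x \<and> curve_section x \<le> 2 * \<bar>R\<bar> + 3" by auto
        qed
      qed measurable
      then show ?thesis using R[of k] by (simp add: m_def measure_distr)
    qed
    then show "\<exists>a b. a < b \<and> (\<forall>k. 1 - e < measure (m k) {a<..b})"
      by (intro exI[of _ "-1"] exI[of _ "2 * \<bar>R\<bar> + 3"]) auto
  qed
  from tight_imp_convergent_subsubsequence[OF this strict_mono_id]
  obtain r M where r: "strict_mono (r :: nat \<Rightarrow> nat)" and M: "real_distribution M" and conv: "weak_conv_m (m \<circ> id \<circ> r) M"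
    by blast
  interpret M: real_distribution M by fact
  define Q where "Q = distr M borel (space_curve :: real \<Rightarrow> 'a)"
  have "borel_prob Q" unfolding Q_def borel_prob_def by (simp add: M.prob_space_distr)
  moreover have "(\<lambda>k. integral\<^sup>L (P (r k)) f) \<longlonglongrightarrow> integral\<^sup>L Q f"
    if f: "continuous_on UNIV f" "bounded (range f)" for f :: "'a \<Rightarrow> real"
  proof -
    have [measurable]: "f \<in> borel_measurable borel" by (rule borel_measurable_continuous_onI[OF f(1)])
    obtain B where B: "\<And>x. norm (f x) \<le> B" using f(2) by (auto simp: bounded_iff)
    have "(\<lambda>k. integral\<^sup>L (m (r k)) (\<lambda>t. f (space_curve t))) \<longlonglongrightarrow> integral\<^sup>L M (\<lambda>t. f (space_curve t))"
    proof (rule weak_conv_imp_integral_bdd_continuous_conv[where B=B])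
      show "isCont (\<lambda>t. f (space_curve t)) x" for x
        using continuous_on_compose2[OF f(1) continuous_space_curve] by (auto simp: continuous_on_eq_continuous_at)
    qed (use m M conv B in \<open>auto simp: comp_def\<close>)
    moreover have "integral\<^sup>L (m (r k)) (\<lambda>t. f (space_curve t)) = integral\<^sup>L (P (r k)) f" for k
      unfolding m_def by (subst integral_distr) (auto simp: space_curve_section)
    moreover have "integral\<^sup>L M (\<lambda>t. f (space_curve t)) = integral\<^sup>L Q f"
      unfolding Q_def by (subst integral_distr) auto
    ultimately show ?thesis by simp
  qed
  ultimately show ?thesis using that r by blast
qed

text \<open>The indicator of an open set is the pointwise limit of the bounded continuous functions
  \<open>min 1 (k * infdist x (- U))\<close>, and open sets generate the Borel sets.\<close>

lemma borel_prob_eqI: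
  fixes M N :: "'a::euclidean_space measure"
  assumes M: "borel_prob M" and N: "borel_prob N"
    and eq: "\<And>f :: 'a \<Rightarrow> real. continuous_on UNIV f \<Longrightarrow> bounded (range f) \<Longrightarrow> integral\<^sup>L M f = integral\<^sup>L N f"
  shows "M = N"
proof -
  have *: "(\<lambda>k. integral\<^sup>L L (\<lambda>x. min 1 (real k * infdist x (- U)))) \<longlonglongrightarrow> measure L U"
    if U: "open U" "U \<noteq> UNIV" and L: "borel_prob L" for L and U :: "'a set"
  proof -
    interpret prob_space L using L by (rule borel_probD)
    note [measurable_cong] = borel_probD(2)[OF L]
    have [measurable]: "U \<in> sets borel" using U by simp
    have [measurable]: "(\<lambda>x. infdist x (- U)) \<in> borel_measurable borel"
      by (intro borel_measurable_continuous_onI continuous_intros)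
    have "(\<lambda>k. integral\<^sup>L L (\<lambda>x. min 1 (real k * infdist x (- U)))) \<longlonglongrightarrow> integral\<^sup>L L (indicator U)"
    proof (rule integral_dominated_convergence[where w="\<lambda>_. 1"])
      show "AE x in L. (\<lambda>k. min 1 (real k * infdist x (- U))) \<longlonglongrightarrow> indicator U x"
      proof (intro AE_I2)
        fix x
        show "(\<lambda>k. min 1 (real k * infdist x (- U))) \<longlonglongrightarrow> indicator U x"
        proof (cases "x \<in> U")
          case True
          then have "infdist x (- U) \<noteq> 0"
            using U in_closed_iff_infdist_zero[of "- U" x] by (auto simp: closed_def)
          then have pos: "infdist x (- U) > 0" using infdist_nonneg[of x "- U"] by linarith
          then obtain k0 :: nat where k0: "1 < real k0 * infdist x (- U)" using reals_Archimedean3 by blast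
          have "min 1 (real k * infdist x (- U)) = 1" if "k \<ge> k0" for k
          proof -
            have "real k0 * infdist x (- U) \<le> real k * infdist x (- U)" using that pos by (intro mult_right_mono) auto
            then show ?thesis using k0 by linarith
          qed
          then have "\<forall>\<^sub>F k in sequentially. min 1 (real k * infdist x (- U)) = 1"
            by (auto simp: eventually_sequentially)
          then show ?thesis using True by (simp add: tendsto_eventually)
        qed (auto simp: infdist_zero)
      qed
    qed (auto simp: infdist_nonneg)
    also have "integral\<^sup>L L (indicator U) = measure L U"
      using borel_probD(3)[OF L] by simp
    finally show ?thesis .
  qed
  have open_eq: "measure M U = measure N U" if "open U" for U
  proof (cases "U = UNIV")
    case True
    then show ?thesis using prob_space.prob_space[OF borel_probD(1)[OF M]] prob_space.prob_space[OF borel_probD(1)[OF N]]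
      by (simp add: borel_probD(3)[OF M] borel_probD(3)[OF N])
  next
    case False
    have "integral\<^sup>L M (\<lambda>x. min 1 (real k * infdist x (- U))) = integral\<^sup>L N (\<lambda>x. min 1 (real k * infdist x (- U)))" for k
    proof (rule eq)
      show "bounded (range (\<lambda>x. min 1 (real k * infdist x (- U))))"
        by (rule boundedI[of _ 1]) (auto simp: infdist_nonneg)
    qed (intro continuous_intros)
    then show ?thesis using *[OF that False M] *[OF that False N] LIMSEQ_unique by simp
  qed
  interpret M: prob_space M using M by (rule borel_probD)
  interpret N: prob_space N using N by (rule borel_probD)
  show ?thesis
  proof (rule measure_eqI_generator_eq[where E="{S. open S}" and \<Omega>=UNIV and A="\<lambda>_. UNIV"])
    show "Int_stable {S::'a set. open S}" by (auto simp: Int_stable_def)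
    show "sets M = sigma_sets UNIV {S. open S}" "sets N = sigma_sets UNIV {S. open S}"
      using borel_probD(2)[OF M] borel_probD(2)[OF N] by (simp_all add: borel_def)
    show "emeasure M X = emeasure N X" if "X \<in> {S. open S}" for X
      using open_eq[of X] that by (simp add: M.emeasure_eq_measure N.emeasure_eq_measure)
  qed auto
qed

lemma borel_prob_tight:
  fixes M :: "'a::euclidean_space measure"
  assumes M: "borel_prob M" and "e > 0"
  shows "\<exists>R. measure M {x. norm x \<le> R} > 1 - e"
proof -
  interpret prob_space M using M by (rule borel_probD)
  note [measurable_cong] = borel_probD(2)[OF M]
  have "(\<lambda>k. measure M {x. norm x \<le> real k}) \<longlonglongrightarrow> measure M (\<Union>k. {x. norm x \<le> real k})"
    by (rule finite_Lim_measure_incseq) (auto simp: incseq_def borel_probD(2)[OF M])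
  also have "(\<Union>k. {x::'a. norm x \<le> real k}) = UNIV" using real_arch_simple by auto
  also have "measure M UNIV = 1" using prob_space by (simp add: borel_probD(3)[OF M])
  finally have "\<forall>\<^sub>F k in sequentially. measure M {x. norm x \<le> real k} > 1 - e"
    by (rule order_tendstoD) (use \<open>e > 0\<close> in auto)
  then show ?thesis by (auto dest: eventually_happens)
qed

lemma transport_planD:
  assumes "transport_plan \<mu> \<nu> \<pi>"
  shows "borel_prob \<pi>" "distr \<pi> borel fst = \<mu>" "distr \<pi> borel snd = \<nu>"
  using assms by (auto simp: transport_plan_def)

lemma borel_prod_sets: "sets (borel :: ('a::euclidean_space \<times> 'a) measure) = sets (borel \<Otimes>\<^sub>M borel)"
  by (metis borel_prod)

text \<open>If \<open>(x, y)\<close> is large then one of \<open>x\<close> and \<open>y\<close> is, which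
  the fixed marginals make unlikely, uniformly in the plan.\<close>

lemma transport_plans_tight:
  fixes \<mu> \<nu> :: "'a::euclidean_space measure"
  assumes \<mu>: "borel_prob \<mu>" and \<nu>: "borel_prob \<nu>" and "e > 0"
  shows "\<exists>R. \<forall>\<pi>. transport_plan \<mu> \<nu> \<pi> \<longrightarrow> measure \<pi> {z. norm z \<le> R} > 1 - e"
proof -
  obtain R1 where R1: "measure \<mu> {x. norm x \<le> R1} > 1 - e/2" using borel_prob_tight[OF \<mu>, of "e/2"] \<open>e > 0\<close> by auto
  obtain R2 where R2: "measure \<nu> {x. norm x \<le> R2} > 1 - e/2" using borel_prob_tight[OF \<nu>, of "e/2"] \<open>e > 0\<close> by auto
  have "measure \<pi> {z. norm z \<le> R1 + R2} > 1 - e" if \<pi>: "transport_plan \<mu> \<nu> \<pi>" for \<pi>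
  proof -
    note b = transport_planD[OF \<pi>]
    interpret prob_space \<pi> using b(1) by (rule borel_probD)
    note [measurable_cong] = borel_probD(2)[OF b(1), unfolded borel_prod_sets]
    note [simp] = borel_probD(3)[OF b(1)]
    have 1: "measure \<mu> {x. norm x \<le> R1} = measure \<pi> {z. norm (fst z) \<le> R1}"
      by (subst b(2)[symmetric], subst measure_distr) (auto simp: vimage_def)
    have 2: "measure \<nu> {x. norm x \<le> R2} = measure \<pi> {z. norm (snd z) \<le> R2}"
      by (subst b(3)[symmetric], subst measure_distr) (auto simp: vimage_def)
    have s: "{z. norm (fst z) \<le> R1} \<in> sets \<pi>" "{z. norm (snd z) \<le> R2} \<in> sets \<pi>"
      "{z. norm z \<le> R1 + R2} \<in> sets \<pi>"
      by (auto simp: borel_probD(2)[OF b(1)] intro!: borel_closed closed_Collect_le continuous_intros)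
    have "measure \<pi> (- {z. norm z \<le> R1 + R2}) \<le> measure \<pi> (- {z. norm (fst z) \<le> R1} \<union> - {z. norm (snd z) \<le> R2})"
    proof (rule finite_measure_mono)
      show "- {z. norm z \<le> R1 + R2} \<subseteq> - {z. norm (fst z) \<le> R1} \<union> - {z. norm (snd z) \<le> R2}"
        by (auto simp: not_le) (meson add_mono norm_Pair_le order_trans)
      show "- {z. norm (fst z) \<le> R1} \<union> - {z. norm (snd z) \<le> R2} \<in> sets \<pi>"
        using s sets.compl_sets[of _ \<pi>] by (auto simp: Compl_eq_Diff_UNIV)
    qed
    also have "\<dots> \<le> measure \<pi> (- {z. norm (fst z) \<le> R1}) + measure \<pi> (- {z. norm (snd z) \<le> R2})"
      using s sets.compl_sets[of _ \<pi>] by (intro measure_Un_le) (auto simp: Compl_eq_Diff_UNIV)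
    finally show ?thesis
      using R1 R2 prob_compl[OF s(1)] prob_compl[OF s(2)] prob_compl[OF s(3)] unfolding 1 2
      by (simp add: Compl_eq_Diff_UNIV)
  qed
  then show ?thesis by blast
qed

text \<open>Marginals pass to weak limits, as projections are continuous.\<close>

lemma transport_plans_compact:
  fixes \<mu> \<nu> :: "'a::euclidean_space measure"
  assumes \<mu>: "borel_prob \<mu>" and \<nu>: "borel_prob \<nu>" and P: "\<And>k. transport_plan \<mu> \<nu> (P k)"
  shows "\<exists>r Q. strict_mono (r :: nat \<Rightarrow> nat) \<and> transport_plan \<mu> \<nu> Q \<and>
    (\<forall>f :: 'a \<times> 'a \<Rightarrow> real. continuous_on UNIV f \<longrightarrow> bounded (range f) \<longrightarrow>
       (\<lambda>k. integral\<^sup>L (P (r k)) f) \<longlonglongrightarrow> integral\<^sup>L Q f)"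
proof -
  note b = transport_planD[OF P]
  have "\<exists>R. \<forall>k. measure (P k) {z. norm z \<le> R} > 1 - e" if "e > 0" for e
    using transport_plans_tight[OF \<mu> \<nu> that] P by blast
  then obtain r Q where r: "strict_mono (r :: nat \<Rightarrow> nat)" and Q: "borel_prob Q" and lim:
    "\<And>f :: 'a \<times> 'a \<Rightarrow> real. continuous_on UNIV f \<Longrightarrow> bounded (range f) \<Longrightarrow>
       (\<lambda>k. integral\<^sup>L (P (r k)) f) \<longlonglongrightarrow> integral\<^sup>L Q f"
    using prokhorov_euclidean[of P, OF b(1)] by blast
  have marg: "distr Q borel g = \<rho>"
    if g: "continuous_on UNIV g" and \<rho>: "borel_prob \<rho>" and Pg: "\<And>k. distr (P k) borel g = \<rho>"
    for g :: "'a \<times> 'a \<Rightarrow> 'a" and \<rho>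
  proof (rule borel_prob_eqI[OF _ \<rho>])
    have g_meas: "g \<in> borel_measurable borel" by (rule borel_measurable_continuous_onI[OF g])
    then have gm: "g \<in> borel_measurable Q" "g \<in> borel_measurable (P k)" for k
      using borel_probD(2)[OF Q] borel_probD(2)[OF b(1)] by (auto cong: measurable_cong_sets)
    show "borel_prob (distr Q borel g)"
      unfolding borel_prob_def using prob_space.prob_space_distr[OF borel_probD(1)[OF Q] gm(1)] by simp
    fix f :: "'a \<Rightarrow> real" assume f: "continuous_on UNIV f" "bounded (range f)"
    have fm: "f \<in> borel_measurable borel" by (rule borel_measurable_continuous_onI[OF f(1)])
    have "(\<lambda>k. integral\<^sup>L (P (r k)) (\<lambda>z. f (g z))) \<longlonglongrightarrow> integral\<^sup>L Q (\<lambda>z. f (g z))"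
      using f by (intro lim continuous_on_compose2[OF f(1) g]) (auto intro: bounded_subset)
    moreover have "integral\<^sup>L (P (r k)) (\<lambda>z. f (g z)) = integral\<^sup>L \<rho> f" for k
      by (subst Pg[of "r k", symmetric], subst integral_distr) (use gm fm in auto)
    ultimately have "integral\<^sup>L Q (\<lambda>z. f (g z)) = integral\<^sup>L \<rho> f"
      by (simp add: LIMSEQ_const_iff)
    then show "integral\<^sup>L (distr Q borel g) f = integral\<^sup>L \<rho> f"
      by (subst integral_distr) (use gm fm in auto)
  qed
  have "transport_plan \<mu> \<nu> Q"
    unfolding transport_plan_def
    using Q marg[OF continuous_on_fst[OF continuous_on_id] \<mu>] marg[OF continuous_on_snd[OF continuous_on_id] \<nu>] b(2,3)
    by auto
  then show ?thesis using r lim by blast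
qed

section \<open>A nonnegative form of the polar cost\<close>

text \<open>The cost as a function of \<open>s = \<langle>x, y\<rangle>\<close>, with \<open>s\<close> added
  to make it nonnegative.\<close>

definition log_part :: "real \<Rightarrow> ennreal" where
  "log_part s = (if s > 1 then ennreal (s - ln (s - 1)) else \<infinity>)"

lemma ln_diff_le: "1 < s \<Longrightarrow> ln (s - 1) \<le> s - (2::real)"
  using ln_le_minus_one[of "s - 1"] by simp

text \<open>Continuity at \<open>s \<le> 1\<close> holds because the logarithm drives the values to
  \<open>\<infinity>\<close> as \<open>s\<close> decreases to 1.\<close>

lemma isCont_log_part: "isCont log_part s"
proof (cases "s > 1")
  case True
  have ev: "\<forall>\<^sub>F t in nhds s. ennreal (t - ln (t - 1)) = log_part t"
    using eventually_nhds_in_open[of "{1<..}" s] True by (auto elim!: eventually_mono simp: log_part_def)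
  have "isCont (\<lambda>t. ennreal (t - ln (t - 1))) s"
    using True by (intro continuous_intros) auto
  then show ?thesis using isCont_cong[OF ev] by blast
next
  case False
  have "(log_part \<longlongrightarrow> \<infinity>) (nhds s)"
    unfolding infinity_ennreal_def
  proof (rule order_tendstoI)
    fix r :: ennreal assume "r < top"
    then obtain r' where r': "r = ennreal r'" "r' \<ge> 0" by (cases r) auto
    have "r < log_part t" if "t < 1 + exp (- r')" for t
    proof (cases "t > 1")
      case True
      have "ln (t - 1) < ln (exp (- r'))" using that True by (subst ln_less_cancel_iff) auto
      then have "r' < t - ln (t - 1)" using True by simp
      then show ?thesis using True r' by (simp add: log_part_def ennreal_less_iff)
    qed (use r' in \<open>auto simp: log_part_def\<close>)
    moreover have "s < 1 + exp (- r')" using False exp_gt_zero[of "- r'"] by linarith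
    then have "\<forall>\<^sub>F t in nhds s. t \<in> {..<1 + exp (- r')}" by (intro eventually_nhds_in_open) auto
    ultimately show "\<forall>\<^sub>F t in nhds s. r < log_part t" by (auto elim!: eventually_mono)
  qed auto
  then have "(log_part \<longlongrightarrow> \<infinity>) (at s)"
    by (rule tendsto_mono[rotated]) (simp add: at_within_def)
  then have "(log_part \<longlongrightarrow> log_part s) (at s)"
    using False by (simp add: log_part_def)
  then show ?thesis by (simp add: isCont_def)
qed

text \<open>The polar cost plus \<open>(|x|^2 + |y|^2) / 2\<close>, which equals \<open>|x - y|^2 / 2 +
  \<langle>x, y\<rangle>\<close>.\<close>

definition shifted_cost :: "'a::euclidean_space \<times> 'a \<Rightarrow> ennreal" where
  "shifted_cost z = ennreal ((norm (fst z - snd z))\<^sup>2 / 2) + log_part (fst z \<bullet> snd z)"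

lemma half_sq_norm_diff:
  "(norm (x - y))\<^sup>2 / 2 + x \<bullet> y = ((norm x)\<^sup>2 + (norm y)\<^sup>2) / 2"
  by (simp add: power2_norm_eq_inner inner_diff_left inner_diff_right inner_commute[of y x] field_simps)

lemma shifted_cost_eq:
  assumes "x \<bullet> y > 1"
  shows "shifted_cost (x, y) = ennreal (((norm x)\<^sup>2 + (norm y)\<^sup>2) / 2 - ln (x \<bullet> y - 1))"
    and "((norm x)\<^sup>2 + (norm y)\<^sup>2) / 2 - ln (x \<bullet> y - 1) \<ge> 0"
proof -
  have "0 \<le> x \<bullet> y - ln (x \<bullet> y - 1)" using ln_diff_le[OF assms] by simp
  moreover from this show "((norm x)\<^sup>2 + (norm y)\<^sup>2) / 2 - ln (x \<bullet> y - 1) \<ge> 0"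
    using half_sq_norm_diff[of x y] zero_le_power2[of "norm (x - y)"] by linarith
  ultimately show "shifted_cost (x, y) = ennreal (((norm x)\<^sup>2 + (norm y)\<^sup>2) / 2 - ln (x \<bullet> y - 1))"
    using assms by (simp add: shifted_cost_def log_part_def half_sq_norm_diff[symmetric] ennreal_plus[symmetric] add_diff_eq del: ennreal_plus)
qed

lemma shifted_cost_eq_top: "\<not> x \<bullet> y > 1 \<Longrightarrow> shifted_cost (x, y) = \<infinity>"
  by (simp add: shifted_cost_def log_part_def)

lemma continuous_shifted_cost: "continuous_on UNIV shifted_cost"
proof -
  have "continuous_on UNIV log_part" by (simp add: continuous_at_imp_continuous_on isCont_log_part)
  then have "continuous_on UNIV (\<lambda>z::'a \<times> 'a. log_part (fst z \<bullet> snd z))"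
    by (rule continuous_on_compose2) (auto intro!: continuous_intros)
  then show ?thesis unfolding shifted_cost_def
    by (intro continuous_on_add_ennreal continuous_on_ennreal continuous_intros) auto
qed

lemma measurable_shifted_cost: "shifted_cost \<in> borel_measurable borel"
  by (rule borel_measurable_continuous_onI[OF continuous_shifted_cost])

definition shifted_plan_cost :: "('a::euclidean_space \<times> 'a) measure \<Rightarrow> ennreal" where
  "shifted_plan_cost \<pi> = (\<integral>\<^sup>+ z. shifted_cost z \<partial>\<pi>)"

text \<open>Passing to the nonnegative cost changes all plan costs by one constant, half the sum of the
  second moments. In particular a plan of least shifted cost is optimal.\<close>

lemma plan_cost_shift:
  fixes \<mu> \<nu> :: "'a::euclidean_space measure"
  assumes "finite_second_moment \<mu>" "finite_second_moment \<nu>"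
  obtains C :: real where
    "\<And>\<pi>. transport_plan \<mu> \<nu> \<pi> \<Longrightarrow> plan_cost \<pi> = enn2ereal (shifted_plan_cost \<pi>) - ereal C"
proof -
  define Cm where "Cm = (\<integral>\<^sup>+ x. ennreal ((norm x)\<^sup>2 / 2) \<partial>\<mu>)"
  define Cn where "Cn = (\<integral>\<^sup>+ x. ennreal ((norm x)\<^sup>2 / 2) \<partial>\<nu>)"
  have fin: "Cm < \<infinity>" "Cn < \<infinity>"
  proof -
    have "integrable \<mu> (\<lambda>x. (norm x)\<^sup>2 / 2)" "integrable \<nu> (\<lambda>x. (norm x)\<^sup>2 / 2)"
      using assms by (auto simp: finite_second_moment_def)
    from integrableD(2)[OF this(1)] integrableD(2)[OF this(2)] 
    show "Cm < \<infinity>" "Cn < \<infinity>" by (auto simp: Cm_def Cn_def less_top)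
  qed
  then obtain C where C: "Cm + Cn = ennreal C" "C \<ge> 0" by (cases "Cm + Cn") auto
  have "plan_cost \<pi> = enn2ereal (shifted_plan_cost \<pi>) - ereal C" if \<pi>: "transport_plan \<mu> \<nu> \<pi>" for \<pi>
  proof -
    note b = transport_planD[OF \<pi>]
    interpret prob_space \<pi> using b(1) by (rule borel_probD)
    have [measurable_cong]: "sets \<pi> = sets (borel \<Otimes>\<^sub>M borel)" using borel_probD(2)[OF b(1)] by (simp add: borel_prod_sets)
    have [measurable]: "shifted_cost \<in> borel_measurable \<pi>"
      using measurable_shifted_cost borel_probD(2)[OF b(1)] by (auto cong: measurable_cong_sets)
    have [measurable]: "(\<lambda>z. polar_cost (fst z) (snd z)) \<in> borel_measurable \<pi>"
      unfolding polar_cost_def by measurable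
    define A where "A = (\<integral>\<^sup>+ z. e2ennreal (polar_cost (fst z) (snd z)) \<partial>\<pi>)"
    define B where "B = (\<integral>\<^sup>+ z. e2ennreal (- polar_cost (fst z) (snd z)) \<partial>\<pi>)"
    define q where "q z = ennreal ((norm (fst z))\<^sup>2 / 2) + ennreal ((norm (snd z))\<^sup>2 / 2)" for z :: "'a \<times> 'a"
    have [measurable]: "q \<in> borel_measurable \<pi>" unfolding q_def by measurable
    have q: "(\<integral>\<^sup>+ z. q z \<partial>\<pi>) = ennreal C"
    proof -
      have "Cm = (\<integral>\<^sup>+ z. ennreal ((norm (fst z))\<^sup>2 / 2) \<partial>\<pi>)"
        unfolding Cm_def by (subst b(2)[symmetric], subst nn_integral_distr) auto
      moreover have "Cn = (\<integral>\<^sup>+ z. ennreal ((norm (snd z))\<^sup>2 / 2) \<partial>\<pi>)"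
        unfolding Cn_def by (subst b(3)[symmetric], subst nn_integral_distr) auto
      ultimately show ?thesis unfolding C(1)[symmetric] q_def by (simp add: nn_integral_add)
    qed
    have pt: "shifted_cost z + e2ennreal (- polar_cost (fst z) (snd z)) = e2ennreal (polar_cost (fst z) (snd z)) + q z"
      and le: "e2ennreal (- polar_cost (fst z) (snd z)) \<le> q z" for z
    proof -
      obtain x y where z: "z = (x, y)" by (cases z)
      have qz: "q z = ennreal (((norm x)\<^sup>2 + (norm y)\<^sup>2) / 2)"
        by (simp add: q_def z ennreal_plus[symmetric] add_divide_distrib del: ennreal_plus)
      have "(shifted_cost z + e2ennreal (- polar_cost (fst z) (snd z)) = e2ennreal (polar_cost (fst z) (snd z)) + q z)
         \<and> e2ennreal (- polar_cost (fst z) (snd z)) \<le> q z"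
      proof (cases "x \<bullet> y > 1")
        case True
        let ?l = "ln (x \<bullet> y - 1)" and ?q = "((norm x)\<^sup>2 + (norm y)\<^sup>2) / 2"
        have l: "?q - ?l \<ge> 0" "?q \<ge> 0" using shifted_cost_eq(2)[OF True] by auto
        have "ennreal (?q - ?l) + ennreal ?l = ennreal (- ?l) + ennreal ?q"
          using l by (cases "?l \<ge> 0") (auto simp: ennreal_plus[symmetric] ennreal_neg simp del: ennreal_plus)
        then show ?thesis using True l
          by (auto simp: z qz[unfolded z] shifted_cost_eq(1)[OF True] polar_cost_def e2ennreal_ereal intro: ennreal_leI)
      next
        case False
        then show ?thesis by (simp add: z shifted_cost_eq_top polar_cost_def e2ennreal_neg)
      qed
      then show "shifted_cost z + e2ennreal (- polar_cost (fst z) (snd z)) = e2ennreal (polar_cost (fst z) (snd z)) + q z"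
        "e2ennreal (- polar_cost (fst z) (snd z)) \<le> q z" by auto
    qed
    have "shifted_plan_cost \<pi> + B = A + ennreal C"
      unfolding shifted_plan_cost_def A_def B_def q[symmetric]
      by (subst (1 2) nn_integral_add[symmetric]) (auto simp: pt)
    moreover have "B \<le> ennreal C" unfolding B_def q[symmetric] by (intro nn_integral_mono le)
    then obtain B' where B': "B = ennreal B'" "B' \<ge> 0" by (cases B) (auto simp: top_unique)
    ultimately have "enn2ereal A - enn2ereal B = enn2ereal (shifted_plan_cost \<pi>) - ereal C"
      using C(2) by (cases A; cases "shifted_plan_cost \<pi>") (auto simp: ennreal_plus[symmetric] top_unique enn2ereal_ennreal simp del: ennreal_plus)
    then show ?thesis by (simp add: plan_cost_def extended_integral_def A_def B_def case_prod_beta)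
  qed
  then show ?thesis using that by blast
qed

section \<open>Existence of an optimal plan\<close>

text \<open>The direct method: along a weakly convergent minimising sequence the integrals of the bounded
  continuous truncations \<open>min N shifted_cost\<close> converge, and monotone convergence in
  \<open>N\<close> shows that the limit plan attains the infimum.\<close>

lemma exists_minimal_plan:
  fixes \<mu> \<nu> :: "'a::euclidean_space measure"
  assumes \<mu>: "borel_prob \<mu>" and \<nu>: "borel_prob \<nu>" and ex: "transport_plan \<mu> \<nu> \<pi>0"
  obtains \<pi> where "transport_plan \<mu> \<nu> \<pi>"
    "\<And>\<pi>'. transport_plan \<mu> \<nu> \<pi>' \<Longrightarrow> shifted_plan_cost \<pi> \<le> shifted_plan_cost \<pi>'"
proof -
  define I where "I = Inf (shifted_plan_cost ` Collect (transport_plan \<mu> \<nu>))"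
  have "\<exists>u. (\<forall>k. u k \<in> shifted_plan_cost ` Collect (transport_plan \<mu> \<nu>)) \<and> u \<longlonglongrightarrow> I"
    unfolding I_def using Inf_as_limit[of "shifted_plan_cost ` Collect (transport_plan \<mu> \<nu>)"] ex by auto
  then obtain u where u: "\<And>k. u k \<in> shifted_plan_cost ` Collect (transport_plan \<mu> \<nu>)" "u \<longlonglongrightarrow> I" by blast
  then obtain P where P: "\<And>k. transport_plan \<mu> \<nu> (P k)" and uP: "\<And>k. u k = shifted_plan_cost (P k)"
    by (simp add: image_iff) metis
  obtain r Q where r: "strict_mono (r :: nat \<Rightarrow> nat)" and Q: "transport_plan \<mu> \<nu> Q" and lim:
    "\<And>f :: 'a \<times> 'a \<Rightarrow> real. continuous_on UNIV f \<Longrightarrow> bounded (range f) \<Longrightarrow>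
       (\<lambda>k. integral\<^sup>L (P (r k)) f) \<longlonglongrightarrow> integral\<^sup>L Q f"
    using transport_plans_compact[of \<mu> \<nu> P, OF \<mu> \<nu> P] by blast
  have trunc: "(\<integral>\<^sup>+ z. min (of_nat N) (shifted_cost z) \<partial>Q) \<le> I" for N :: nat
  proof -
    define f where "f z = enn2real (min (of_nat N) (shifted_cost z))" for z :: "'a \<times> 'a"
    have fz: "ennreal (f z) = min (of_nat N) (shifted_cost z)" for z
      unfolding f_def by (intro ennreal_enn2real) (auto simp: min_less_iff_disj of_nat_less_top)
    have f01: "0 \<le> f z" "f z \<le> N" for z
    proof -
      show "0 \<le> f z" by (simp add: f_def)
      have "ennreal (f z) \<le> ennreal (real N)" by (simp add: fz ennreal_of_nat_eq_real_of_nat)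
      then show "f z \<le> N" by (simp add: ennreal_le_iff)
    qed
    have cont: "continuous_on UNIV f"
    proof -
      have "isCont (\<lambda>z::'a \<times> 'a. min (of_nat N) (shifted_cost z)) w" for w
        using continuous_on_min[OF continuous_on_const[of UNIV "of_nat N"] continuous_shifted_cost]
        unfolding continuous_on_eq_continuous_at[OF open_UNIV] by blast
      then have "((\<lambda>z. min (of_nat N) (shifted_cost z)) \<longlongrightarrow> ennreal (f w)) (at w)" for w
        by (simp add: isCont_def fz)
      then have "(f \<longlongrightarrow> f w) (at w)" for w
        unfolding f_def[abs_def] by (rule tendsto_enn2real) (simp add: f_def)
      then show ?thesis unfolding continuous_on_def by blast
    qed
    have bdd: "bounded (range f)" using f01 by (intro boundedI[of _ "real N"]) auto
    have int: "ennreal (integral\<^sup>L \<pi> f) = (\<integral>\<^sup>+ z. min (of_nat N) (shifted_cost z) \<partial>\<pi>)"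
      if "transport_plan \<mu> \<nu> \<pi>" for \<pi>
    proof -
      note b = transport_planD[OF that]
      interpret prob_space \<pi> using b(1) by (rule borel_probD)
      have "f \<in> borel_measurable \<pi>"
        using borel_measurable_continuous_onI[OF cont] borel_probD(2)[OF b(1)] by (auto cong: measurable_cong_sets)
      then have "integrable \<pi> f"
        by (intro integrable_const_bound[where B=N]) (use f01 in auto)
      then show ?thesis using nn_integral_eq_integral[of \<pi> f] f01 by (simp add: fz)
    qed
    have "(\<lambda>k. ennreal (integral\<^sup>L (P (r k)) f)) \<longlonglongrightarrow> ennreal (integral\<^sup>L Q f)"
      by (intro tendsto_ennrealI lim cont bdd)
    moreover have "(\<lambda>k. u (r k)) \<longlonglongrightarrow> I" using LIMSEQ_subseq_LIMSEQ[OF u(2) r] by (simp add: comp_def)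
    moreover have "ennreal (integral\<^sup>L (P (r k)) f) \<le> u (r k)" for k
      unfolding int[OF P] uP shifted_plan_cost_def by (intro nn_integral_mono) auto
    ultimately have "ennreal (integral\<^sup>L Q f) \<le> I" by (intro LIMSEQ_le) auto
    then show ?thesis by (simp add: int[OF Q])
  qed
  have "shifted_plan_cost Q = (\<integral>\<^sup>+ z. (SUP N. min (of_nat N) (shifted_cost z)) \<partial>Q)"
    unfolding shifted_plan_cost_def
  proof (rule nn_integral_cong)
    fix z :: "'a \<times> 'a"
    show "shifted_cost z = (SUP N. min (of_nat N) (shifted_cost z))"
    proof -
      have "(SUP N. min (of_nat N) (shifted_cost z)) = min (SUP N. of_nat N) (shifted_cost z)"
        using SUP_inf[of of_nat UNIV "shifted_cost z"] by (simp add: inf_min)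
      then show ?thesis by (simp add: ennreal_SUP_of_nat_eq_top)
    qed
  qed
  also have "\<dots> = (SUP N. \<integral>\<^sup>+ z. min (of_nat N) (shifted_cost z) \<partial>Q)"
  proof (rule nn_integral_monotone_convergence_SUP)
    show "incseq (\<lambda>N z. min (of_nat N) (shifted_cost z))"
      by (auto simp: incseq_def le_fun_def intro: min.coboundedI1)
    show "(\<lambda>z. min (of_nat N) (shifted_cost z)) \<in> borel_measurable Q" for N
    proof -
      note [measurable] = measurable_shifted_cost
      note [measurable_cong] = borel_probD(2)[OF transport_planD(1)[OF Q]]
      show ?thesis by measurable
    qed
  qed
  also have "\<dots> \<le> I" using trunc by (intro SUP_least)
  finally have "shifted_plan_cost Q \<le> I" .
  then have "shifted_plan_cost Q \<le> shifted_plan_cost \<pi>'" if "transport_plan \<mu> \<nu> \<pi>'" for \<pi>'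
    unfolding I_def using that by (meson INF_lower2 Inf_lower image_eqI mem_Collect_eq order_trans)
  then show ?thesis using that Q by blast
qed

section \<open>Supports of measures\<close>

definition measure_support :: "'b::topological_space measure \<Rightarrow> 'b set" where
  "measure_support M = {x. \<forall>U. open U \<longrightarrow> x \<in> U \<longrightarrow> emeasure M U > 0}"

lemma closed_measure_support: "closed (measure_support M)"
proof -
  have "- measure_support M = \<Union>{U. open U \<and> emeasure M U = 0}"
    by (auto simp: measure_support_def zero_less_iff_neq_zero)
  then have "open (- measure_support M)" by (simp add: open_Union)
  then show ?thesis by (simp add: closed_def)
qed

text \<open>The complement of the support is a union of null sets from a countable basis.\<close>

lemma AE_measure_support:
  fixes M :: "'b::second_countable_topology measure"
  assumes M: "sets M = sets borel"
  shows "AE x in M. x \<in> measure_support M"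
proof -
  obtain B :: "'b set set" where B: "countable B" "topological_basis B" using ex_countable_basis by blast
  let ?N = "{U \<in> B. emeasure M U = 0}"
  have "AE x in M. \<forall>U\<in>?N. x \<notin> U"
  proof (subst AE_ball_countable)
    show "countable ?N" using B(1) by simp
    show "\<forall>U\<in>?N. AE x in M. x \<notin> U"
    proof
      fix U assume U: "U \<in> ?N"
      then have "open U" using topological_basis_open[OF B(2)] by simp
      then have "U \<in> null_sets M" using U M by (intro null_setsI) auto
      then show "AE x in M. x \<notin> U" by (rule AE_not_in)
    qed
  qed
  then show ?thesis
  proof eventually_elim
    fix x assume x: "\<forall>U\<in>?N. x \<notin> U"
    show "x \<in> measure_support M"
      unfolding measure_support_def
    proof (intro CollectI allI impI)
      fix U assume U: "open U" "x \<in> U"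
      then obtain V where V: "V \<in> B" "x \<in> V" "V \<subseteq> U" using topological_basisE[OF B(2)] by metis
      have "emeasure M V \<le> emeasure M U" using V U M by (intro emeasure_mono) auto
      moreover have "emeasure M V > 0" using x V by (auto simp: zero_less_iff_neq_zero)
      ultimately show "emeasure M U > 0" by simp
    qed
  qed
qed

section \<open>Cyclical monotonicity\<close>

text \<open>Cyclical monotonicity, by comparison with an explicit competitor. Draw independent samples from
  \<open>\<pi>\<close>; whenever permuting the first components of the first \<open>N\<close> of
  them along \<open>\<sigma>\<close> lowers their total cost, do so; then pick one of the
  \<open>N\<close> resulting pairs at random. Permuting does not alter the average of the laws
  of either component, so the law of the random pair is again a plan with the same marginals.
  Infinitely many samples are drawn only so that the sample with any index exists.\<close>

context
  fixes \<pi> :: "('a::euclidean_space \<times> 'a) measure" and \<sigma> :: "nat \<Rightarrow> nat" and N :: nat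
  assumes pi: "borel_prob \<pi>" and \<sigma>: "bij_betw \<sigma> {..<N} {..<N}" and N: "N > 0"
begin

definition swap_gain :: "(nat \<Rightarrow> 'a \<times> 'a) \<Rightarrow> bool" where
  "swap_gain z \<longleftrightarrow> (\<Sum>i<N. shifted_cost (fst (z (\<sigma> i)), snd (z i))) < (\<Sum>i<N. shifted_cost (z i))"

definition swapped :: "nat \<Rightarrow> (nat \<Rightarrow> 'a \<times> 'a) \<Rightarrow> 'a \<times> 'a" where
  "swapped i z = (if swap_gain z then (fst (z (\<sigma> i)), snd (z i)) else z i)"

definition swapped_plan :: "('a \<times> 'a) measure" where
  "swapped_plan = distr (measure_pmf (pmf_of_set {..<N}) \<Otimes>\<^sub>M Pi\<^sub>M UNIV (\<lambda>_. \<pi>)) borel (\<lambda>(i, z). swapped i z)"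

lemma measurable_swapped: "(\<lambda>(i, z). swapped i z) \<in> measure_pmf U \<Otimes>\<^sub>M Pi\<^sub>M UNIV (\<lambda>_. \<pi>) \<rightarrow>\<^sub>M borel"
  and measurable_swapped': "swapped i \<in> Pi\<^sub>M UNIV (\<lambda>_. \<pi>) \<rightarrow>\<^sub>M borel"
proof -
  have s: "sets \<pi> = sets (borel \<Otimes>\<^sub>M borel)" using borel_probD(2)[OF pi] by (simp add: borel_prod_sets)
  have [measurable]: "(\<lambda>z. fst (z i)) \<in> Pi\<^sub>M UNIV (\<lambda>_. \<pi>) \<rightarrow>\<^sub>M borel" "(\<lambda>z. snd (z i)) \<in> Pi\<^sub>M UNIV (\<lambda>_. \<pi>) \<rightarrow>\<^sub>M borel" for i
    using s measurable_component_singleton[of i UNIV "\<lambda>_. \<pi>"]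
    by (auto intro!: measurable_fst'' measurable_snd'' cong: measurable_cong_sets)
  have [measurable]: "(shifted_cost :: 'a \<times> 'a \<Rightarrow> ennreal) \<in> borel_measurable (borel \<Otimes>\<^sub>M borel)"
    using measurable_shifted_cost by (simp add: borel_prod)
  have "(\<lambda>z. shifted_cost (fst (z i), snd (z i))) \<in> borel_measurable (Pi\<^sub>M UNIV (\<lambda>_. \<pi>))" for i by measurable
  then have [measurable]: "(\<lambda>z. shifted_cost (z i)) \<in> borel_measurable (Pi\<^sub>M UNIV (\<lambda>_. \<pi>))" for i by simp
  have [measurable]: "Measurable.pred (Pi\<^sub>M UNIV (\<lambda>_. \<pi>)) swap_gain"
    unfolding swap_gain_def by measurable
  have "(\<lambda>z. if swap_gain z then (fst (z (\<sigma> i)), snd (z i)) else (fst (z i), snd (z i))) \<in> Pi\<^sub>M UNIV (\<lambda>_. \<pi>) \<rightarrow>\<^sub>M borel \<Otimes>\<^sub>M borel" for i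
    by measurable
  moreover have "swapped i = (\<lambda>z. if swap_gain z then (fst (z (\<sigma> i)), snd (z i)) else (fst (z i), snd (z i)))" for i
    by (auto simp: swapped_def fun_eq_iff)
  ultimately show *: "swapped i \<in> Pi\<^sub>M UNIV (\<lambda>_. \<pi>) \<rightarrow>\<^sub>M borel" for i
    unfolding borel_prod by simp
  have "sets (measure_pmf U \<Otimes>\<^sub>M Pi\<^sub>M UNIV (\<lambda>_. \<pi>)) = sets (count_space UNIV \<Otimes>\<^sub>M Pi\<^sub>M UNIV (\<lambda>_. \<pi>))"
    by (intro sets_pair_measure_cong) auto
  then show "(\<lambda>(i, z). swapped i z) \<in> measure_pmf U \<Otimes>\<^sub>M Pi\<^sub>M UNIV (\<lambda>_. \<pi>) \<rightarrow>\<^sub>M borel"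
    using measurable_pair_measure_countable1[of UNIV "\<lambda>(i, z). swapped i z" "Pi\<^sub>M UNIV (\<lambda>_. \<pi>)" borel] *
    by (simp cong: measurable_cong_sets)
qed

lemma prob_space_samples: "prob_space (Pi\<^sub>M UNIV (\<lambda>_::nat. \<pi>))"
  by (intro prob_space_PiM borel_probD(1) pi)

lemma nn_integral_swapped_plan:
  fixes g :: "'a \<times> 'a \<Rightarrow> ennreal"
  assumes g: "g \<in> borel_measurable borel"
  shows "(\<integral>\<^sup>+ w. g w \<partial>swapped_plan) = (\<integral>\<^sup>+ z. (\<Sum>i<N. g (swapped i z)) \<partial>Pi\<^sub>M UNIV (\<lambda>_. \<pi>)) / N"
proof -
  interpret S: prob_space "Pi\<^sub>M UNIV (\<lambda>_::nat. \<pi>)" by (rule prob_space_samples)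
  note measurable_swapped[measurable] g[measurable] measurable_swapped'[measurable]
  have "(\<integral>\<^sup>+ w. g w \<partial>swapped_plan) =
     (\<integral>\<^sup>+ p. g (case p of (i, z) \<Rightarrow> swapped i z) \<partial>(measure_pmf (pmf_of_set {..<N}) \<Otimes>\<^sub>M Pi\<^sub>M UNIV (\<lambda>_. \<pi>)))"
    unfolding swapped_plan_def by (subst nn_integral_distr) auto
  also have "\<dots> = (\<integral>\<^sup>+ i. \<integral>\<^sup>+ z. g (swapped i z) \<partial>Pi\<^sub>M UNIV (\<lambda>_. \<pi>) \<partial>measure_pmf (pmf_of_set {..<N}))"
    by (subst S.nn_integral_fst[symmetric]) auto
  also have "\<dots> = (\<Sum>i<N. \<integral>\<^sup>+ z. g (swapped i z) \<partial>Pi\<^sub>M UNIV (\<lambda>_. \<pi>)) / N"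
    using N by (subst nn_integral_pmf_of_set) (auto simp: lessThan_empty_iff)
  finally show ?thesis by (simp add: nn_integral_sum)
qed

lemma nn_integral_samples:
  fixes g :: "'a \<times> 'a \<Rightarrow> ennreal"
  assumes g: "g \<in> borel_measurable borel"
  shows "(\<integral>\<^sup>+ w. g w \<partial>\<pi>) = (\<integral>\<^sup>+ z. (\<Sum>i<N. g (z i)) \<partial>Pi\<^sub>M UNIV (\<lambda>_. \<pi>)) / N"
proof -
  have g'[measurable]: "g \<in> borel_measurable \<pi>" using g borel_probD(2)[OF pi] by (auto cong: measurable_cong_sets)
  have "(\<integral>\<^sup>+ z. g (z i) \<partial>Pi\<^sub>M UNIV (\<lambda>_::nat. \<pi>)) = (\<integral>\<^sup>+ w. g w \<partial>\<pi>)" for i :: nat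
    by (subst (2) distr_PiM_component[of UNIV "\<lambda>_. \<pi>" i, symmetric])
       (auto simp: nn_integral_distr borel_probD(1)[OF pi])
  then have "(\<integral>\<^sup>+ z. (\<Sum>i<N. g (z i)) \<partial>Pi\<^sub>M UNIV (\<lambda>_. \<pi>)) = of_nat N * (\<integral>\<^sup>+ w. g w \<partial>\<pi>)"
    by (subst nn_integral_sum) auto
  then show ?thesis using N
    by (simp add: mult.commute[of "of_nat N"] mult_divide_eq_ennreal)
qed

text \<open>Summed over the sample, a function of one component alone does not notice the permutation.\<close>

lemma nn_integral_swapped_plan_marginal:
  fixes h :: "'a \<Rightarrow> ennreal"
  assumes h: "h \<in> borel_measurable borel"
  shows "(\<integral>\<^sup>+ w. h (fst w) \<partial>swapped_plan) = (\<integral>\<^sup>+ w. h (fst w) \<partial>\<pi>)"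
    "(\<integral>\<^sup>+ w. h (snd w) \<partial>swapped_plan) = (\<integral>\<^sup>+ w. h (snd w) \<partial>\<pi>)"
proof -
  have "(\<lambda>w::'a\<times>'a. h (fst w)) \<in> borel_measurable (borel \<Otimes>\<^sub>M borel)" "(\<lambda>w::'a\<times>'a. h (snd w)) \<in> borel_measurable (borel \<Otimes>\<^sub>M borel)"
    using h by measurable
  then have m: "(\<lambda>w::'a\<times>'a. h (fst w)) \<in> borel_measurable borel" "(\<lambda>w::'a\<times>'a. h (snd w)) \<in> borel_measurable borel"
    by (simp_all add: borel_prod)
  have "(\<Sum>i<N. h (fst (swapped i z))) = (\<Sum>i<N. h (fst (z i)))" for z
    using sum.reindex_bij_betw[OF \<sigma>, of "\<lambda>i. h (fst (z i))"]
    by (cases "swap_gain z") (simp_all add: swapped_def)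
  then show "(\<integral>\<^sup>+ w. h (fst w) \<partial>swapped_plan) = (\<integral>\<^sup>+ w. h (fst w) \<partial>\<pi>)"
    by (simp add: nn_integral_swapped_plan[OF m(1)] nn_integral_samples[OF m(1)])
  have "(\<Sum>i<N. h (snd (swapped i z))) = (\<Sum>i<N. h (snd (z i)))" for z
    by (cases "swap_gain z") (simp_all add: swapped_def)
  then show "(\<integral>\<^sup>+ w. h (snd w) \<partial>swapped_plan) = (\<integral>\<^sup>+ w. h (snd w) \<partial>\<pi>)"
    by (simp add: nn_integral_swapped_plan[OF m(2)] nn_integral_samples[OF m(2)])
qed

lemma transport_plan_swapped:
  assumes plan: "transport_plan \<mu> \<nu> \<pi>"
  shows "transport_plan \<mu> \<nu> swapped_plan"
proof -
  interpret S: prob_space "Pi\<^sub>M UNIV (\<lambda>_::nat. \<pi>)" by (rule prob_space_samples)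
  interpret SS: pair_prob_space "measure_pmf (pmf_of_set {..<N})" "Pi\<^sub>M UNIV (\<lambda>_::nat. \<pi>)" ..
  have sw: "borel_prob swapped_plan"
    unfolding borel_prob_def swapped_plan_def by (simp add: SS.prob_space_distr[OF measurable_swapped])
  have m: "g \<in> borel_measurable M" if "continuous_on UNIV g" "borel_prob M" for g :: "'a \<times> 'a \<Rightarrow> 'a" and M
    using borel_measurable_continuous_onI[OF that(1)] borel_probD(2)[OF that(2)] by (auto cong: measurable_cong_sets)
  have "distr swapped_plan borel fst = distr \<pi> borel fst"
  proof (rule measure_eqI)
    fix A assume "A \<in> sets (distr swapped_plan borel fst)"
    then have A: "A \<in> sets borel" by simp
    have *: "emeasure (distr M borel fst) A = (\<integral>\<^sup>+ w. indicator A (fst w) \<partial>M)" if "borel_prob M" for M :: "('a\<times>'a) measure"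
    proof -
      have "emeasure (distr M borel fst) A = (\<integral>\<^sup>+ x. indicator A x \<partial>distr M borel fst)" using A by simp
      also have "\<dots> = (\<integral>\<^sup>+ w. indicator A (fst w) \<partial>M)"
        using A m[OF continuous_on_fst[OF continuous_on_id] that] by (intro nn_integral_distr) auto
      finally show ?thesis .
    qed
    show "emeasure (distr swapped_plan borel fst) A = emeasure (distr \<pi> borel fst) A"
      using A by (simp add: *[OF sw] *[OF pi] nn_integral_swapped_plan_marginal)
  qed simp
  moreover have "distr swapped_plan borel snd = distr \<pi> borel snd"
  proof (rule measure_eqI)
    fix A assume "A \<in> sets (distr swapped_plan borel snd)"
    then have A: "A \<in> sets borel" by simp
    have *: "emeasure (distr M borel snd) A = (\<integral>\<^sup>+ w. indicator A (snd w) \<partial>M)" if "borel_prob M" for M :: "('a\<times>'a) measure"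
    proof -
      have "emeasure (distr M borel snd) A = (\<integral>\<^sup>+ x. indicator A x \<partial>distr M borel snd)" using A by simp
      also have "\<dots> = (\<integral>\<^sup>+ w. indicator A (snd w) \<partial>M)"
        using A m[OF continuous_on_snd[OF continuous_on_id] that] by (intro nn_integral_distr) auto
      finally show ?thesis .
    qed
    show "emeasure (distr swapped_plan borel snd) A = emeasure (distr \<pi> borel snd) A"
      using A by (simp add: *[OF sw] *[OF pi] nn_integral_swapped_plan_marginal)
  qed simp
  ultimately show ?thesis using plan sw by (simp add: transport_plan_def)
qed

text \<open>Swapping never raises the total cost, and strictly lowers it where there is a gain. If that had
  positive probability, the competitor would be strictly cheaper than the optimal plan.\<close>

lemma AE_no_swap_gain:
  assumes plan: "transport_plan \<mu> \<nu> \<pi>"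
    and min: "\<And>\<pi>'. transport_plan \<mu> \<nu> \<pi>' \<Longrightarrow> shifted_plan_cost \<pi> \<le> shifted_plan_cost \<pi>'"
    and fin: "shifted_plan_cost \<pi> < \<infinity>"
  shows "AE z in Pi\<^sub>M UNIV (\<lambda>_. \<pi>). \<not> swap_gain z"
proof (rule ccontr)
  assume gain: "\<not> ?thesis"
  let ?S = "Pi\<^sub>M UNIV (\<lambda>_::nat. \<pi>)"
  let ?f = "\<lambda>z. \<Sum>i<N. shifted_cost (swapped i z)" and ?g = "\<lambda>z. \<Sum>i<N. shifted_cost (z i)"
  note sc = measurable_shifted_cost[where 'a='a]
  note [measurable] = measurable_swapped' sc
  have comp: "(\<lambda>z. z i) \<in> ?S \<rightarrow>\<^sub>M borel" for i
    using measurable_component_singleton[of i UNIV "\<lambda>_. \<pi>"] borel_probD(2)[OF pi] by (auto cong: measurable_cong_sets)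
  note [measurable] = comp
  have eqs: "shifted_plan_cost swapped_plan = (\<integral>\<^sup>+ z. ?f z \<partial>?S) / N" "shifted_plan_cost \<pi> = (\<integral>\<^sup>+ z. ?g z \<partial>?S) / N"
    unfolding shifted_plan_cost_def by (rule nn_integral_swapped_plan[OF sc], rule nn_integral_samples[OF sc])
  have swapped_eq: "?f z = (if swap_gain z then \<Sum>i<N. shifted_cost (fst (z (\<sigma> i)), snd (z i)) else ?g z)" for z
    by (cases "swap_gain z") (simp_all add: swapped_def)
  have le: "?f z \<le> ?g z" for z
    unfolding swapped_eq by (auto simp: swap_gain_def)
  have fg: "(\<integral>\<^sup>+ z. ?g z \<partial>?S) < \<infinity>"
  proof (rule ccontr)
    assume "\<not> ?thesis"
    then have "(\<integral>\<^sup>+ z. ?g z \<partial>?S) = top" using top.not_eq_extremum unfolding infinity_ennreal_def by blast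
    then show False using fin N by (simp add: eqs ennreal_top_divide)
  qed
  have "(\<integral>\<^sup>+ z. ?f z \<partial>?S) < (\<integral>\<^sup>+ z. ?g z \<partial>?S)"
  proof (rule nn_integral_less)
    show "\<not> (AE z in ?S. ?g z \<le> ?f z)"
    proof
      assume "AE z in ?S. ?g z \<le> ?f z"
      then have "AE z in ?S. \<not> swap_gain z"
        unfolding swapped_eq by eventually_elim (auto simp: swap_gain_def)
      then show False using gain by simp
    qed
    have "(\<integral>\<^sup>+ z. ?f z \<partial>?S) \<le> (\<integral>\<^sup>+ z. ?g z \<partial>?S)" by (intro nn_integral_mono le)
    then show "(\<integral>\<^sup>+ z. ?f z \<partial>?S) \<noteq> \<infinity>" using fg by (auto simp: top_unique)
  qed (use le in auto)
  then have "shifted_plan_cost swapped_plan < shifted_plan_cost \<pi>"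
    unfolding eqs using N
    by (subst divide_less_ennreal) (auto simp: ennreal_divide_times ennreal_divide_self of_nat_less_top)
  then show False using min[OF transport_plan_swapped[OF plan]] by simp
qed

text \<open>A gain at some points of the support would persist, by continuity of the cost, on a product of
  neighbourhoods, which has positive probability.\<close>

lemma cyclical_monotonicity:
  assumes plan: "transport_plan \<mu> \<nu> \<pi>"
    and min: "\<And>\<pi>'. transport_plan \<mu> \<nu> \<pi>' \<Longrightarrow> shifted_plan_cost \<pi> \<le> shifted_plan_cost \<pi>'"
    and fin: "shifted_plan_cost \<pi> < \<infinity>"
    and z: "\<And>i. i < N \<Longrightarrow> z i \<in> measure_support \<pi>"
  shows "(\<Sum>i<N. shifted_cost (z i)) \<le> (\<Sum>i<N. shifted_cost (fst (z (\<sigma> i)), snd (z i)))"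
proof (rule ccontr)
  assume "\<not> ?thesis"
  then have "swap_gain z" by (simp add: swap_gain_def not_le)
  have proj: "continuous_on UNIV (\<lambda>z::nat \<Rightarrow> 'a \<times> 'a. z i)" for i
    by (rule continuous_on_product_coordinates)
  have "continuous_on UNIV (\<lambda>z::nat \<Rightarrow> 'a \<times> 'a. shifted_cost (fst (z j), snd (z i)))" for i j
    using proj by (intro continuous_on_compose2[OF continuous_shifted_cost]) (auto intro!: continuous_intros)
  then have sums: "continuous_on UNIV (\<lambda>z::nat \<Rightarrow> 'a \<times> 'a. \<Sum>i<n. shifted_cost (fst (z (\<tau> i)), snd (z i)))" for \<tau> and n :: nat
    by (induction n) (auto intro!: continuous_on_add_ennreal)
  have "open {z :: nat \<Rightarrow> 'a \<times> 'a. swap_gain z}"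
    unfolding swap_gain_def using sums[of \<sigma> N] sums[of "\<lambda>i. i" N] by (intro open_Collect_less) auto
  then have "openin (product_topology (\<lambda>_. euclidean) UNIV) {z :: nat \<Rightarrow> 'a \<times> 'a. swap_gain z}"
    by (simp add: open_fun_def)
  from product_topology_open_contains_basis[OF this, of z] \<open>swap_gain z\<close>
  have "\<exists>X. z \<in> (\<Pi>\<^sub>E i\<in>UNIV. X i) \<and> (\<forall>i. openin euclidean (X i)) \<and> (\<Pi>\<^sub>E i\<in>UNIV. X i) \<subseteq> {z. swap_gain z}"
    by blast
  then obtain X where X: "z \<in> (\<Pi>\<^sub>E i\<in>UNIV. X i)" "\<And>i. openin euclidean (X i)"
    "(\<Pi>\<^sub>E i\<in>UNIV. X i) \<subseteq> {z. swap_gain z}"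
    by blast
  have op: "open (X i)" for i using X(2)[of i] open_openin[of "X i"] by blast
  let ?S = "Pi\<^sub>M UNIV (\<lambda>_::nat. \<pi>)"
  let ?E = "{w \<in> space ?S. \<forall>i\<in>{..<N}. w i \<in> X i}"
  interpret product_prob_space "\<lambda>_::nat. \<pi>" UNIV
    by (intro product_prob_spaceI borel_probD(1) pi)
  have XS: "X i \<in> sets \<pi>" for i using op by (simp add: borel_probD(2)[OF pi])
  have "emeasure ?S ?E = (\<Prod>i<N. emeasure \<pi> (X i))"
    by (rule emeasure_PiM_Collect) (auto simp: XS)
  also have "\<dots> > 0"
  proof -
    have "emeasure \<pi> (X i) > 0" if "i < N" for i
      using z[OF that] op[of i] X(1) by (auto simp: measure_support_def)
    then show ?thesis by (auto simp: zero_less_iff_neq_zero)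
  qed
  finally have pos: "emeasure ?S ?E > 0" .
  have gain: "swap_gain w" if "w \<in> ?E" for w
  proof -
    have \<sigma>N: "\<sigma> i < N" if "i < N" for i using \<sigma> that by (auto simp: bij_betw_def)
    \<comment> \<open>Open sets of the product topology restrict finitely many coordinates, possibly beyond \<open>N\<close>; only those below \<open>N\<close> affect the gain.\<close>
    define w' where "w' i = (if i < N then w i else z i)" for i
    have "w' i \<in> X i" for i using that X(1) by (auto simp: w'_def)
    then have "swap_gain w'" using X(3) by auto
    moreover have "(\<Sum>i<N. shifted_cost (fst (w' (\<sigma> i)), snd (w' i))) = (\<Sum>i<N. shifted_cost (fst (w (\<sigma> i)), snd (w i)))"
      "(\<Sum>i<N. shifted_cost (w' i)) = (\<Sum>i<N. shifted_cost (w i))"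
      by (auto intro!: sum.cong simp: w'_def \<sigma>N)
    ultimately show ?thesis by (simp add: swap_gain_def)
  qed
  have E: "?E \<in> sets ?S" using XS by measurable
  have "AE w in ?S. \<not> (w \<in> ?E)"
  proof -
    have "AE w in ?S. \<not> swap_gain w" by (rule AE_no_swap_gain[OF plan min fin])
    then show ?thesis by eventually_elim (use gain in blast)
  qed
  then have "emeasure ?S ?E = 0" using E AE_iff_measurable[OF E] by (simp add: sets.sets_into_space) 
  then show False using pos by simp
qed

end

section \<open>Path weights and the potential\<close>

text \<open>The cost of matching the first component of \<open>b\<close> with the second component of
  \<open>a\<close> is \<open>- ln (gap a b)\<close>, and it is finite exactly if the gap is
  positive.\<close>

definition gap :: "'a::euclidean_space \<times> 'a \<Rightarrow> 'a \<times> 'a \<Rightarrow> real" where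
  "gap a b = fst b \<bullet> snd a - 1"

text \<open>Paths step from \<open>b\<close> to \<open>c\<close> when \<open>gap b c > 0\<close>. The weight
  of a path is the exponential of the cost that is saved by matching the second component of
  each point but the last with the first component of its successor.\<close>

inductive path_weight :: "('a::euclidean_space \<times> 'a) set \<Rightarrow> 'a \<times> 'a \<Rightarrow> 'a \<times> 'a \<Rightarrow> real \<Rightarrow> bool"
  for \<Gamma> where
  refl: "a \<in> \<Gamma> \<Longrightarrow> path_weight \<Gamma> a a 1"
| step: "path_weight \<Gamma> a b w \<Longrightarrow> c \<in> \<Gamma> \<Longrightarrow> gap b c > 0 \<Longrightarrow> path_weight \<Gamma> a c (w * (gap b c / gap b b))"

text \<open>The quadratic terms of the shifted cost cancel in this inequality, so it is cyclical
  monotonicity for the polar cost itself.\<close>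

definition polar_cyclically_monotone :: "('a::euclidean_space \<times> 'a) set \<Rightarrow> bool" where
  "polar_cyclically_monotone \<Gamma> \<longleftrightarrow> (\<forall>N \<sigma> (z :: nat \<Rightarrow> 'a \<times> 'a). bij_betw \<sigma> {..<N} {..<N} \<longrightarrow> (\<forall>i<N. z i \<in> \<Gamma>) \<longrightarrow>
     (\<Sum>i<N. shifted_cost (z i)) \<le> (\<Sum>i<N. shifted_cost (fst (z (\<sigma> i)), snd (z i))))"

context
  fixes \<Gamma> :: "('a::euclidean_space \<times> 'a) set"
  assumes gap_pos: "\<And>a. a \<in> \<Gamma> \<Longrightarrow> gap a a > 0"
begin

lemma path_weight_in: "path_weight \<Gamma> a b w \<Longrightarrow> a \<in> \<Gamma> \<and> b \<in> \<Gamma>"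
  by (induction rule: path_weight.induct) auto

lemma path_weight_pos: "path_weight \<Gamma> a b w \<Longrightarrow> w > 0"
proof (induction rule: path_weight.induct)
  case (step a b w c)
  then show ?case using gap_pos[of b] path_weight_in[OF step.hyps(1)] by simp
qed simp

lemma path_weight_trans:
  assumes "path_weight \<Gamma> b c v" "path_weight \<Gamma> a b w"
  shows "path_weight \<Gamma> a c (w * v)"
  using assms
proof (induction rule: path_weight.induct)
  case (step b c v d)
  then show ?case using path_weight.step[of \<Gamma> a c "w * v" d] by (simp add: mult.assoc)
qed simp

lemma path_weight_sequence:
  assumes "path_weight \<Gamma> a b w"
  shows "\<exists>N z. z 0 = a \<and> z N = b \<and> (\<forall>i\<le>N. z i \<in> \<Gamma>) \<and> (\<forall>i<N. gap (z i) (z (Suc i)) > 0) \<and>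
     w = (\<Prod>i<N. gap (z i) (z (Suc i)) / gap (z i) (z i))"
  using assms
proof (induction rule: path_weight.induct)
  case (refl a)
  then show ?case by (intro exI[of _ 0] exI[of _ "\<lambda>_. a"]) auto
next
  case (step a b w c)
  then obtain N z where z: "z 0 = a" "z N = b" "\<forall>i\<le>N. z i \<in> \<Gamma>" "\<forall>i<N. gap (z i) (z (Suc i)) > 0"
    "w = (\<Prod>i<N. gap (z i) (z (Suc i)) / gap (z i) (z i))" by blast
  define y where "y = z(Suc N := c)"
  have "(\<Prod>i<N. gap (y i) (y (Suc i)) / gap (y i) (y i)) = (\<Prod>i<N. gap (z i) (z (Suc i)) / gap (z i) (z i))"
    by (intro prod.cong) (auto simp: y_def)
  then have "y 0 = a \<and> y (Suc N) = c \<and> (\<forall>i\<le>Suc N. y i \<in> \<Gamma>) \<and> (\<forall>i<Suc N. gap (y i) (y (Suc i)) > 0) \<and>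
     w * (gap b c / gap b b) = (\<Prod>i<Suc N. gap (y i) (y (Suc i)) / gap (y i) (y i))"
    using z step.hyps by (auto simp: y_def less_Suc_eq le_Suc_eq)
  then show ?case by blast
qed

lemma shifted_cost_gap:
  assumes "gap b a > 0"
  shows "shifted_cost (fst a, snd b) = ennreal (((norm (fst a))\<^sup>2 + (norm (snd b))\<^sup>2) / 2 - ln (gap b a))"
    "((norm (fst a))\<^sup>2 + (norm (snd b))\<^sup>2) / 2 - ln (gap b a) \<ge> 0"
  using shifted_cost_eq[of "fst a" "snd b"] assms by (auto simp: gap_def)

text \<open>This is cyclical monotonicity for the cyclic shift of the points of the path, after taking
  logarithms.\<close>

lemma closed_path_weight_le_1:
  assumes cyc: "polar_cyclically_monotone \<Gamma>" and "path_weight \<Gamma> a a w"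
  shows "w \<le> 1"
proof -
  obtain N z where z: "z 0 = a" "z N = a" "\<forall>i\<le>N. z i \<in> \<Gamma>" and pos: "\<And>i. i < N \<Longrightarrow> gap (z i) (z (Suc i)) > 0"
    and w: "w = (\<Prod>i<N. gap (z i) (z (Suc i)) / gap (z i) (z i))"
    using path_weight_sequence[OF assms(2)] by blast
  define \<sigma> where "\<sigma> i = (if Suc i = N then 0 else Suc i)" for i
  have z\<sigma>: "z (\<sigma> i) = z (Suc i)" for i using z by (auto simp: \<sigma>_def)
  have \<sigma>: "bij_betw \<sigma> {..<N} {..<N}"
  proof (rule bij_betwI')
    show "\<exists>x\<in>{..<N}. y = \<sigma> x" if "y \<in> {..<N}" for y
      using that by (intro bexI[of _ "if y = 0 then N - 1 else y - 1"]) (auto simp: \<sigma>_def)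
  qed (auto simp: \<sigma>_def split: if_splits)
  have posi: "gap (z i) (z i) > 0" if "i < N" for i using gap_pos z(3) that by auto
  let ?q = "\<lambda>i j. ((norm (fst (z j)))\<^sup>2 + (norm (snd (z i)))\<^sup>2) / 2"
  have "(\<Sum>i<N. shifted_cost (z i)) \<le> (\<Sum>i<N. shifted_cost (fst (z (\<sigma> i)), snd (z i)))"
    using cyc \<sigma> z(3) unfolding polar_cyclically_monotone_def by auto
  moreover have "(\<Sum>i<N. shifted_cost (z i)) = ennreal (\<Sum>i<N. ?q i i - ln (gap (z i) (z i)))"
    using posi shifted_cost_gap[of "z i" "z i" for i]
    by (subst sum_ennreal[symmetric]) (auto intro!: sum.cong)
  moreover have "(\<Sum>i<N. shifted_cost (fst (z (\<sigma> i)), snd (z i))) = ennreal (\<Sum>i<N. ?q i (\<sigma> i) - ln (gap (z i) (z (Suc i))))"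
    using pos shifted_cost_gap[of "z i" "z (Suc i)" for i]
    by (subst sum_ennreal[symmetric]) (auto intro!: sum.cong simp: z\<sigma>)
  moreover have "(\<Sum>i<N. ?q i (\<sigma> i) - ln (gap (z i) (z (Suc i)))) \<ge> 0"
    using pos shifted_cost_gap(2)[of "z i" "z (Suc i)" for i] by (intro sum_nonneg) (auto simp: z\<sigma>)
  ultimately have "(\<Sum>i<N. ?q i i - ln (gap (z i) (z i))) \<le> (\<Sum>i<N. ?q i (\<sigma> i) - ln (gap (z i) (z (Suc i))))"
    by (simp add: ennreal_le_iff)
  moreover have "(\<Sum>i<N. (norm (fst (z (\<sigma> i))))\<^sup>2) = (\<Sum>i<N. (norm (fst (z i)))\<^sup>2)"
    by (rule sum.reindex_bij_betw[OF \<sigma>, of "\<lambda>i. (norm (fst (z i)))\<^sup>2"])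
  ultimately have "(\<Sum>i<N. ln (gap (z i) (z (Suc i)))) \<le> (\<Sum>i<N. ln (gap (z i) (z i)))"
    by (simp add: sum_subtractf sum.distrib add_divide_distrib sum_divide_distrib[symmetric])
  moreover have "ln w = (\<Sum>i<N. ln (gap (z i) (z (Suc i)))) - (\<Sum>i<N. ln (gap (z i) (z i)))"
  proof -
    have "ln w = (\<Sum>i<N. ln (gap (z i) (z (Suc i)) / gap (z i) (z i)))"
      unfolding w
    proof (rule ln_prod)
      fix i assume "i \<in> {..<N}"
      then show "gap (z i) (z (Suc i)) / gap (z i) (z i) \<noteq> 0"
        using pos[of i] posi[of i] by simp
    qed simp
    also have "\<dots> = (\<Sum>i<N. ln (gap (z i) (z (Suc i))) - ln (gap (z i) (z i)))"
      using pos posi by (intro sum.cong refl ln_divide_pos) auto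
    finally show ?thesis by (simp add: sum_subtractf)
  qed
  ultimately have "ln w \<le> 0" by simp
  then show ?thesis using path_weight_pos[OF assms(2)] by simp
qed

context
  fixes a0 :: "'a \<times> 'a"
  assumes cyc: "polar_cyclically_monotone \<Gamma>"
    and conn: "\<And>a b. a \<in> \<Gamma> \<Longrightarrow> b \<in> \<Gamma> \<Longrightarrow> \<exists>w. path_weight \<Gamma> a b w"
    and a0: "a0 \<in> \<Gamma>"
begin

text \<open>The supremum is finite because a path back from \<open>b\<close> to \<open>a0\<close> closes
  every path from \<open>a0\<close> to \<open>b\<close> to a cycle, whose weight is at most 1.\<close>

definition max_weight :: "'a \<times> 'a \<Rightarrow> real" where
  "max_weight b = Sup {w. path_weight \<Gamma> a0 b w}"

lemma bdd_path_weights: assumes "b \<in> \<Gamma>" shows "bdd_above {w. path_weight \<Gamma> a0 b w}"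
proof -
  obtain v where v: "path_weight \<Gamma> b a0 v" using conn assms a0 by blast
  have "w \<le> 1 / v" if "path_weight \<Gamma> a0 b w" for w
    using closed_path_weight_le_1[OF cyc path_weight_trans[OF v that]] path_weight_pos[OF v]
    by (simp add: field_simps)
  then show ?thesis by (intro bdd_aboveI[of _ "1/v"]) auto
qed

lemma max_weight_ge: "path_weight \<Gamma> a0 b w \<Longrightarrow> w \<le> max_weight b"
  unfolding max_weight_def using bdd_path_weights path_weight_in by (intro cSup_upper) auto

lemma max_weight_pos: "b \<in> \<Gamma> \<Longrightarrow> max_weight b > 0"
  using conn[OF a0] path_weight_pos max_weight_ge by (meson less_le_trans)

text \<open>If there is an edge from \<open>b\<close> to \<open>c\<close>, every path to \<open>b\<close>
  extends to a path to \<open>c\<close>; otherwise the left side is at most 0.\<close>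

lemma max_weight_step:
  assumes "b \<in> \<Gamma>" "c \<in> \<Gamma>"
  shows "max_weight b / gap b b * gap b c \<le> max_weight c"
proof (cases "gap b c > 0")
  case True
  have "max_weight b \<le> max_weight c / (gap b c / gap b b)"
    unfolding max_weight_def[of b]
  proof (rule cSup_least)
    show "{w. path_weight \<Gamma> a0 b w} \<noteq> {}" using conn[OF a0 assms(1)] by auto
    fix w assume "w \<in> {w. path_weight \<Gamma> a0 b w}"
    then have "w * (gap b c / gap b b) \<le> max_weight c"
      using True assms by (intro max_weight_ge path_weight.step) auto
    then show "w \<le> max_weight c / (gap b c / gap b b)"
      using True gap_pos[OF assms(1)] by (subst pos_le_divide_eq) auto
  qed
  then show ?thesis using True gap_pos[OF assms(1)] by (simp add: field_simps)
next
  case False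
  then have "max_weight b / gap b b * gap b c \<le> 0"
    using max_weight_pos[OF assms(1)] gap_pos[OF assms(1)] by (intro mult_nonneg_nonpos) auto
  then show ?thesis using max_weight_pos[OF assms(2)] by simp
qed

text \<open>The potential of Rockafellar's construction, for the cost \<open>- ln (\<langle>x, y\<rangle> -
  1)\<close> and written multiplicatively: the logarithm of each member of the family is a path
  sum whose last term depends on \<open>x\<close>.\<close>

definition potential :: "'a \<Rightarrow> ennreal" where
  "potential x = (SUP a\<in>\<Gamma>. ennreal (max_weight a / gap a a * max 0 (x \<bullet> snd a - 1)))"

lemma potential_Cvx0: "potential \<in> Cvx0"
  unfolding Cvx0_def
proof (intro CollectI conjI allI impI)
  have c: "0 \<le> max_weight a / gap a a" if "a \<in> \<Gamma>" for a
    using max_weight_pos[OF that] gap_pos[OF that] by simp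
  fix x
  show "potential x \<le> Liminf (at x) potential"
    unfolding potential_def[of x]
  proof (rule SUP_least)
    fix a assume a: "a \<in> \<Gamma>"
    let ?f = "\<lambda>x. ennreal (max_weight a / gap a a * max 0 (x \<bullet> snd a - 1))"
    have "(?f \<longlongrightarrow> ?f x) (at x)" by (intro tendsto_intros)
    then have "?f x = Liminf (at x) ?f" by (intro lim_imp_Liminf[symmetric]) auto
    also have "\<dots> \<le> Liminf (at x) potential"
      unfolding potential_def[abs_def] using a by (intro Liminf_mono always_eventually allI SUP_upper)
    finally show "?f x \<le> Liminf (at x) potential" .
  qed
  fix y and u v :: real
  assume uv: "0 \<le> u" "0 \<le> v" "u + v = 1"
  show "potential (u *\<^sub>R x + v *\<^sub>R y) \<le> ennreal u * potential x + ennreal v * potential y"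
    unfolding potential_def[of "u *\<^sub>R x + v *\<^sub>R y"]
  proof (rule SUP_least)
    fix a assume a: "a \<in> \<Gamma>"
    let ?c = "max_weight a / gap a a"
    let ?f = "\<lambda>x. ?c * max 0 (x \<bullet> snd a - 1)"
    have eq: "(u *\<^sub>R x + v *\<^sub>R y) \<bullet> snd a - 1 = u * (x \<bullet> snd a - 1) + v * (y \<bullet> snd a - 1)"
      using uv by (simp add: inner_add_left algebra_simps)
    have "max 0 ((u *\<^sub>R x + v *\<^sub>R y) \<bullet> snd a - 1) \<le> u * max 0 (x \<bullet> snd a - 1) + v * max 0 (y \<bullet> snd a - 1)"
      unfolding eq using uv by (auto intro!: add_mono mult_left_mono add_nonneg_nonneg)
    then have "?f (u *\<^sub>R x + v *\<^sub>R y) \<le> ?c * (u * max 0 (x \<bullet> snd a - 1) + v * max 0 (y \<bullet> snd a - 1))"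
      using c[OF a] by (intro mult_left_mono)
    also have "\<dots> = u * ?f x + v * ?f y" by (simp add: algebra_simps)
    finally have "ennreal (?f (u *\<^sub>R x + v *\<^sub>R y)) \<le> ennreal (u * ?f x + v * ?f y)" by (rule ennreal_leI)
    also have "\<dots> = ennreal u * ennreal (?f x) + ennreal v * ennreal (?f y)"
      using uv mult_nonneg_nonneg[OF c[OF a], of "max 0 (x \<bullet> snd a - 1)"] mult_nonneg_nonneg[OF c[OF a], of "max 0 (y \<bullet> snd a - 1)"]
      by (simp only: ennreal_plus ennreal_mult mult_nonneg_nonneg max.cobounded1)
    also have "\<dots> \<le> ennreal u * potential x + ennreal v * potential y"
      unfolding potential_def using a by (intro add_mono mult_left_mono SUP_upper2[OF a]) auto
    finally show "ennreal (?f (u *\<^sub>R x + v *\<^sub>R y)) \<le> ennreal u * potential x + ennreal v * potential y" .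
  qed
next
  show "potential 0 = 0" by (simp add: potential_def bot_ennreal[symmetric])
qed

text \<open>The supremum is attained by the member belonging to \<open>b\<close>, as the others are bounded
  by \<open>max_weight_step\<close>.\<close>

lemma potential_eq: assumes b: "b \<in> \<Gamma>" shows "potential (fst b) = ennreal (max_weight b)"
proof (rule antisym)
  show "potential (fst b) \<le> ennreal (max_weight b)"
    unfolding potential_def
  proof (intro SUP_least ennreal_leI)
    fix a assume a: "a \<in> \<Gamma>"
    show "max_weight a / gap a a * max 0 (fst b \<bullet> snd a - 1) \<le> max_weight b"
      using max_weight_step[OF a b] max_weight_pos[OF b] by (auto simp: gap_def max_def)
  qed
  have "max_weight b = max_weight b / gap b b * max 0 (fst b \<bullet> snd b - 1)"
    using gap_pos[OF b] by (simp add: gap_def)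
  then show "ennreal (max_weight b) \<le> potential (fst b)"
    unfolding potential_def using b by (intro SUP_upper2[OF b]) simp
qed

text \<open>The member of the family belonging to \<open>b\<close> bounds the potential from below by a
  multiple of \<open>\<langle>x, snd b\<rangle> - 1\<close>, which bounds the polarity transform
  at \<open>snd b\<close> from above; at \<open>x = fst b\<close> both bounds are equalities.\<close>

lemma potential_polar_subdifferential:
  assumes b: "b \<in> \<Gamma>"
  shows "snd b \<in> polar_subdifferential potential (fst b)"
proof -
  have W: "max_weight b > 0" and g: "gap b b > 0" using max_weight_pos gap_pos b by auto
  have "polarity_transform potential (snd b) = ennreal (gap b b / max_weight b)"
    unfolding polarity_transform_def
  proof (rule antisym)
    show "(SUP x\<in>{x. 1 < x \<bullet> snd b}. ennreal (x \<bullet> snd b - 1) / potential x) \<le> ennreal (gap b b / max_weight b)"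
    proof (rule SUP_least)
      fix x assume "x \<in> {x. 1 < x \<bullet> snd b}"
      then have x: "x \<bullet> snd b - 1 > 0" by simp
      let ?v = "ennreal (max_weight b / gap b b * (x \<bullet> snd b - 1))"
      have v: "?v \<le> potential x"
        unfolding potential_def using x by (intro SUP_upper2[OF b]) simp
      have "0 < ?v" using x W g by simp
      then have "0 < potential x" using v by (rule less_le_trans)
      moreover have "ennreal (x \<bullet> snd b - 1) = ?v * ennreal (gap b b / max_weight b)"
        using x W g by (subst ennreal_mult[symmetric]) auto
      then have "ennreal (x \<bullet> snd b - 1) \<le> potential x * ennreal (gap b b / max_weight b)"
        using mult_right_mono[OF v, of "ennreal (gap b b / max_weight b)"] by simp
      ultimately show "ennreal (x \<bullet> snd b - 1) / potential x \<le> ennreal (gap b b / max_weight b)"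
        by (rule divide_le_posI_ennreal)
    qed
    show "ennreal (gap b b / max_weight b) \<le> (SUP x\<in>{x. 1 < x \<bullet> snd b}. ennreal (x \<bullet> snd b - 1) / potential x)"
      using g W by (intro SUP_upper2[of "fst b"]) (auto simp: potential_eq[OF b] gap_def divide_ennreal)
  qed
  then show ?thesis
    unfolding polar_subdifferential_def potential_eq[OF b] using W g
    by (auto simp: ennreal_mult[symmetric] gap_def ennreal_eq_0_iff)
qed

end

end

section \<open>Almost everywhere uniqueness in the polar subdifferential\<close>

text \<open>By Tonelli and translation invariance, the measure of \<open>S\<close> times the length of the
  line is the integral over \<open>x\<close> of the lengths of the sections of \<open>S\<close>
  along the line through \<open>x\<close>, and these vanish.\<close>

lemma null_set_if_line_sections_single:
  fixes S :: "'a::euclidean_space set"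
  assumes S: "S \<in> sets borel" and single: "\<And>x s t. x + s *\<^sub>R e \<in> S \<Longrightarrow> x + t *\<^sub>R e \<in> S \<Longrightarrow> s = t"
  shows "S \<in> null_sets lborel"
proof -
  note S[measurable]
  have m[measurable]: "(\<lambda>(x, t). indicator S (x + t *\<^sub>R e) :: ennreal) \<in> borel_measurable (lborel \<Otimes>\<^sub>M lborel)"
    by measurable
  have "(\<integral>\<^sup>+ t. indicator S (x + t *\<^sub>R e) \<partial>(lborel :: real measure)) = 0" for x
  proof -
    have "{t. x + t *\<^sub>R e \<in> S} \<subseteq> {SOME t. x + t *\<^sub>R e \<in> S}"
      using single by (auto intro: someI2)
    then have "countable {t. x + t *\<^sub>R e \<in> S}" using countable_subset by blast
    then have "emeasure lborel {t. x + t *\<^sub>R e \<in> S} = 0" by (rule emeasure_lborel_countable)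
    moreover have "(\<integral>\<^sup>+ t. indicator S (x + t *\<^sub>R e) \<partial>(lborel :: real measure)) = (\<integral>\<^sup>+ t. indicator {t. x + t *\<^sub>R e \<in> S} t \<partial>lborel)"
      by (intro nn_integral_cong) (auto simp: indicator_def)
    ultimately show ?thesis by (simp add: nn_integral_indicator)
  qed
  then have "0 = (\<integral>\<^sup>+ x. \<integral>\<^sup>+ t. indicator S (x + t *\<^sub>R e) \<partial>(lborel :: real measure) \<partial>lborel)" by simp
  also have "\<dots> = (\<integral>\<^sup>+ t. \<integral>\<^sup>+ x. indicator S (x + t *\<^sub>R e) \<partial>lborel \<partial>(lborel :: real measure))"
    using lborel_pair.Fubini'[OF m] by simp
  also have "\<dots> = (\<integral>\<^sup>+ t. emeasure lborel S \<partial>(lborel :: real measure))"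
  proof (rule nn_integral_cong)
    fix t :: real
    have "emeasure lborel S = (\<integral>\<^sup>+ x. indicator S x \<partial>distr lborel borel ((+) (t *\<^sub>R e)))"
      by (simp add: lborel_distr_plus)
    also have "\<dots> = (\<integral>\<^sup>+ x. indicator S (x + t *\<^sub>R e) \<partial>lborel)"
      by (subst nn_integral_distr) (auto simp: add.commute)
    finally show "(\<integral>\<^sup>+ x. indicator S (x + t *\<^sub>R e) \<partial>lborel) = emeasure lborel S" by simp
  qed
  finally have "emeasure lborel S = 0" by (auto simp: ennreal_mult_eq_top_iff split: if_splits)
  then show ?thesis using S by (intro null_setsI) auto
qed

text \<open>The points at which all slopes in \<open>[p, q]\<close> along \<open>e\<close> are subgradients
  of the restriction of \<open>f\<close> to the line in direction \<open>e\<close>.\<close>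

definition kinks :: "'a::euclidean_space set \<Rightarrow> ('a \<Rightarrow> real) \<Rightarrow> real \<Rightarrow> real \<Rightarrow> 'a \<Rightarrow> 'a set" where
  "kinks U f p q e = {x\<in>U. \<forall>h. x + h *\<^sub>R e \<in> U \<longrightarrow> f x + q * h \<le> f (x + h *\<^sub>R e) \<and> f x + p * h \<le> f (x + h *\<^sub>R e)}"

text \<open>From a kink at \<open>s\<close> to one at \<open>t > s\<close> on the same line, the values
  would grow by at least \<open>q * (t - s)\<close>, seen from \<open>s\<close>, and by at most
  \<open>p * (t - s)\<close>, seen from \<open>t\<close>.\<close>

lemma null_set_kinks:
  assumes U: "open U" and f: "continuous_on U f" and "p < q"
  shows "kinks U f p q e \<in> null_sets lborel"
proof (rule null_set_if_line_sections_single)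
  define V where "V r h = {x\<in>U. x + h *\<^sub>R e \<in> U \<and> f (x + h *\<^sub>R e) - f x - r * h < 0}" for r h
  have "open (V r h)" for r h
  proof -
    let ?W = "U \<inter> (\<lambda>x. x + h *\<^sub>R e) -` U"
    have W: "open ?W"
      by (intro continuous_open_preimage[OF _ U U] continuous_intros)
    have "continuous_on ?W (\<lambda>x. f (x + h *\<^sub>R e) - f x - r * h)"
      by (intro continuous_intros continuous_on_compose2[OF f] continuous_on_subset[OF f]) auto
    from continuous_open_preimage[OF this W, of "{..<0}"]
    have "open (?W \<inter> (\<lambda>x. f (x + h *\<^sub>R e) - f x - r * h) -` {..<0})" by simp
    also have "?W \<inter> (\<lambda>x. f (x + h *\<^sub>R e) - f x - r * h) -` {..<0} = V r h" by (auto simp: V_def)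
    finally show ?thesis .
  qed
  then have "open (\<Union>h. V q h \<union> V p h)" by auto
  moreover have "kinks U f p q e = U - (\<Union>h. V q h \<union> V p h)"
    by (auto simp: kinks_def V_def not_less)
  ultimately show "kinks U f p q e \<in> sets borel" using U by (simp add: borel_open sets.Diff)
next
  have no: False if "x + s *\<^sub>R e \<in> kinks U f p q e" "x + t *\<^sub>R e \<in> kinks U f p q e" "s < t" for x s t
  proof -
    have a: "x + s *\<^sub>R e + (t - s) *\<^sub>R e = x + t *\<^sub>R e" "x + t *\<^sub>R e + (s - t) *\<^sub>R e = x + s *\<^sub>R e"
      by (simp_all add: scaleR_left_diff_distrib)
    have "f (x + s *\<^sub>R e) + q * (t - s) \<le> f (x + t *\<^sub>R e)"
      using that(1,2) a(1) unfolding kinks_def by (metis (no_types, lifting) mem_Collect_eq)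
    moreover have "f (x + t *\<^sub>R e) + p * (s - t) \<le> f (x + s *\<^sub>R e)"
      using that(1,2) a(2) unfolding kinks_def by (metis (no_types, lifting) mem_Collect_eq)
    ultimately have "(q - p) * (t - s) \<le> 0" by (simp add: algebra_simps)
    then show False using \<open>p < q\<close> that(3) by (simp add: mult_le_0_iff)
  qed
  show "s = t" if "x + s *\<^sub>R e \<in> kinks U f p q e" "x + t *\<^sub>R e \<in> kinks U f p q e" for x s t
    using no[of x s t] no[of x t s] that by (cases s t rule: linorder_cases) auto
qed

text \<open>Two different subgradients differ along some basis direction, and then their point is a kink for
  two rational slopes in between.\<close>

lemma AE_unique_subgradient:
  fixes f :: "'a::euclidean_space \<Rightarrow> real"
  assumes U: "open U" and f: "continuous_on U f"
  shows "AE x in lborel. x \<in> U \<longrightarrow> (\<forall>g1 g2. (\<forall>y\<in>U. f x + g1 \<bullet> (y - x) \<le> f y) \<longrightarrow> (\<forall>y\<in>U. f x + g2 \<bullet> (y - x) \<le> f y) \<longrightarrow> g1 = g2)"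
proof -
  let ?I = "{(p, q, e). p \<in> \<rat> \<and> q \<in> \<rat> \<and> p < q \<and> e \<in> (Basis :: 'a set)}"
  have "AE x in lborel. \<forall>(p, q, e)\<in>?I. x \<notin> kinks U f p q e"
  proof (subst AE_ball_countable)
    have "countable (\<rat> \<times> \<rat> \<times> (Basis :: 'a set))" by (intro countable_SIGMA countable_rat countable_finite) auto
    then show "countable ?I" by (rule countable_subset[rotated]) auto
    show "\<forall>i\<in>?I. AE x in lborel. case i of (p, q, e) \<Rightarrow> x \<notin> kinks U f p q e"
      using null_set_kinks[OF U f] by (auto intro: AE_not_in)
  qed
  then show ?thesis
  proof (eventually_elim, intro impI allI)
    fix x g1 g2
    assume x: "\<forall>(p, q, e)\<in>?I. x \<notin> kinks U f p q e" "x \<in> U"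
      and g: "\<forall>y\<in>U. f x + g1 \<bullet> (y - x) \<le> f y" "\<forall>y\<in>U. f x + g2 \<bullet> (y - x) \<le> f y"
    have no: False if e: "e \<in> Basis" and lt: "a \<bullet> e < b \<bullet> e"
      and a: "\<forall>y\<in>U. f x + a \<bullet> (y - x) \<le> f y" and b: "\<forall>y\<in>U. f x + b \<bullet> (y - x) \<le> f y" for a b e
    proof -
      \<comment> \<open>Rational slopes leave countably many null sets to avoid.\<close>
      obtain p where p: "p \<in> \<rat>" "a \<bullet> e < p" "p < b \<bullet> e" using Rats_dense_in_real[OF lt] by blast
      obtain q where q: "q \<in> \<rat>" "p < q" "q < b \<bullet> e" using Rats_dense_in_real[OF p(3)] by blast
      have "f x + r * h \<le> f (x + h *\<^sub>R e)" if r: "a \<bullet> e \<le> r" "r \<le> b \<bullet> e" and "x + h *\<^sub>R e \<in> U" for r h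
      proof (cases "h \<ge> 0")
        case True
        then have "r * h \<le> b \<bullet> e * h" using r by (intro mult_right_mono)
        moreover have "f x + b \<bullet> (h *\<^sub>R e) \<le> f (x + h *\<^sub>R e)" using b that(3) by force
        ultimately show ?thesis by (simp add: mult.commute)
      next
        case False
        then have "r * h \<le> a \<bullet> e * h" using r by (intro mult_right_mono_neg) auto
        moreover have "f x + a \<bullet> (h *\<^sub>R e) \<le> f (x + h *\<^sub>R e)" using a that(3) by force
        ultimately show ?thesis by (simp add: mult.commute)
      qed
      then have "x \<in> kinks U f p q e" unfolding kinks_def using x(2) p q by auto
      then show False using x(1) p q e by auto
    qed
    show "g1 = g2"
    proof (rule ccontr)
      assume "g1 \<noteq> g2"
      then obtain e where "e \<in> Basis" "g1 \<bullet> e \<noteq> g2 \<bullet> e" using euclidean_eqI[of g1 g2] by blast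
      then show False using no[of e g1 g2] no[of e g2 g1] g by (cases "g1 \<bullet> e" "g2 \<bullet> e" rule: linorder_cases) auto
    qed
  qed
qed

text \<open>Division by \<open>x \<bullet> y - 1\<close> turns the last inequality into the statement that
  an affine function touches \<open>\<phi>\<close> from below at \<open>x\<close>.\<close>

lemma polar_subdifferential_inequality:
  assumes y: "y \<in> polar_subdifferential \<phi> x"
  shows "x \<bullet> y > 1" "\<phi> x < \<infinity>" "enn2real (\<phi> x) > 0"
    and "\<phi> x' < \<infinity> \<Longrightarrow> enn2real (\<phi> x) * (x' \<bullet> y - 1) \<le> (x \<bullet> y - 1) * enn2real (\<phi> x')"
proof -
  have \<phi>x: "\<phi> x \<noteq> 0" "\<phi> x \<noteq> \<infinity>" and eq: "\<phi> x * polarity_transform \<phi> y = ennreal (x \<bullet> y - 1)" and pos: "x \<bullet> y - 1 > 0"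
    using y by (auto simp: polar_subdifferential_def split: if_splits)
  then show "x \<bullet> y > 1" "\<phi> x < \<infinity>" "enn2real (\<phi> x) > 0"
    by (auto simp: less_top enn2real_positive_iff zero_less_iff_neq_zero)
  obtain u where u: "\<phi> x = ennreal u" "u > 0"
    using \<phi>x by (cases "\<phi> x") (auto simp: ennreal_eq_0_iff not_le)
  have "polarity_transform \<phi> y \<noteq> top"
  proof
    assume "polarity_transform \<phi> y = top"
    then have "\<phi> x * polarity_transform \<phi> y = top" using \<phi>x by (simp add: ennreal_mult_top)
    then show False using eq by simp
  qed
  then obtain r where r: "polarity_transform \<phi> y = ennreal r" "r \<ge> 0" by (cases "polarity_transform \<phi> y") auto
  have ur: "u * r = x \<bullet> y - 1"
    using eq u r pos by (simp add: ennreal_mult[symmetric])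
  assume "\<phi> x' < \<infinity>"
  then obtain v where v: "\<phi> x' = ennreal v" "v \<ge> 0" by (cases "\<phi> x'") auto
  show "enn2real (\<phi> x) * (x' \<bullet> y - 1) \<le> (x \<bullet> y - 1) * enn2real (\<phi> x')"
  proof (cases "x' \<bullet> y > 1")
    case True
    have le: "ennreal (x' \<bullet> y - 1) / \<phi> x' \<le> ennreal r"
      unfolding r(1)[symmetric] polarity_transform_def using True by (intro SUP_upper) auto
    have "v \<noteq> 0"
    proof
      assume "v = 0"
      then have "ennreal (x' \<bullet> y - 1) / \<phi> x' = top" using v True by (simp add: ennreal_divide_eq_top_iff)
      then show False using le by (simp add: top_unique)
    qed
    then have "(x' \<bullet> y - 1) / v \<le> r" using le v r True by (simp add: divide_ennreal)
    then have "x' \<bullet> y - 1 \<le> r * v" using v \<open>v \<noteq> 0\<close> by (simp add: pos_divide_le_eq)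
    then have "u * (x' \<bullet> y - 1) \<le> u * (r * v)" using u by (intro mult_left_mono) auto
    then show ?thesis using u v by (simp add: ur[symmetric] mult.assoc)
  next
    case False
    then have "u * (x' \<bullet> y - 1) \<le> 0" using u by (simp add: mult_le_0_iff)
    also have "0 \<le> (x \<bullet> y - 1) * v" using pos v by simp
    finally show ?thesis using u v by simp
  qed
qed

lemma Cvx0_convexD:
  assumes "\<phi> \<in> Cvx0" "0 \<le> u" "0 \<le> v" "u + v = 1"
  shows "\<phi> (u *\<^sub>R x + v *\<^sub>R y) \<le> ennreal u * \<phi> x + ennreal v * \<phi> y"
  using assms by (auto simp: Cvx0_def)

text \<open>Almost every point of the convex set where \<open>\<phi>\<close> is finite lies in its interior,
  where \<open>\<phi>\<close> is continuous and has almost everywhere a unique subgradient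
  \<open>g\<close>. If \<open>g = \<phi> x / s *\<^sub>R y\<close> with \<open>s = x \<bullet> y
  - 1\<close>, then \<open>x \<bullet> g = \<phi> x * (1 + 1 / s)\<close> determines
  \<open>s\<close>, and with it \<open>y\<close>.\<close>

lemma AE_polar_subdifferential_unique:
  fixes \<phi> :: "'a::euclidean_space \<Rightarrow> ennreal"
  assumes \<phi>: "\<phi> \<in> Cvx0"
  shows "AE x in lborel. \<forall>y1\<in>polar_subdifferential \<phi> x. \<forall>y2\<in>polar_subdifferential \<phi> x. y1 = y2"
proof -
  define D where "D = {x. \<phi> x < \<infinity>}"
  define U where "U = interior D"
  define f where "f x = enn2real (\<phi> x)" for x
  have conv: "u *\<^sub>R x + v *\<^sub>R y \<in> D \<and> f (u *\<^sub>R x + v *\<^sub>R y) \<le> u * f x + v * f y"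
    if xy: "x \<in> D" "y \<in> D" and uv: "0 \<le> u" "0 \<le> v" "u + v = 1" for x y u v
  proof -
    obtain s t where st: "\<phi> x = ennreal s" "s \<ge> 0" "\<phi> y = ennreal t" "t \<ge> 0"
      using xy by (cases "\<phi> x"; cases "\<phi> y") (auto simp: D_def)
    have le: "\<phi> (u *\<^sub>R x + v *\<^sub>R y) \<le> ennreal (u * s + v * t)"
      using Cvx0_convexD[OF \<phi> uv, of x y] st uv by (simp add: ennreal_plus ennreal_mult)
    then have "\<phi> (u *\<^sub>R x + v *\<^sub>R y) < \<infinity>" by (simp add: le_less_trans)
    moreover have "f (u *\<^sub>R x + v *\<^sub>R y) \<le> u * s + v * t"
      unfolding f_def using st uv by (intro enn2real_leI le) auto
    ultimately show ?thesis using st by (simp add: D_def f_def)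
  qed
  have D: "convex D" unfolding convex_def using conv by auto
  have "convex_on D f"
    using conv D by (auto simp: convex_on_def)
  then have "convex_on U f" unfolding U_def
    by (rule convex_on_subset[OF _ interior_subset]) (use D in \<open>auto intro: convex_interior\<close>)
  then have cont: "continuous_on U f" unfolding U_def by (intro convex_on_continuous) auto
  have "frontier D \<in> null_sets lborel"
  proof -
    have "negligible (frontier D)" by (rule negligible_convex_frontier[OF D])
    then have "frontier D \<in> null_sets lebesgue" by (simp add: negligible_iff_null_sets)
    moreover have "frontier D \<in> sets borel" by (simp add: borel_closed)
    ultimately show ?thesis by (simp add: null_sets_completion_iff)
  qed
  then have "AE x in lborel. x \<notin> frontier D" by (rule AE_not_in)
  moreover have "AE x in lborel. x \<in> U \<longrightarrow> (\<forall>g1 g2. (\<forall>y\<in>U. f x + g1 \<bullet> (y - x) \<le> f y) \<longrightarrow> (\<forall>y\<in>U. f x + g2 \<bullet> (y - x) \<le> f y) \<longrightarrow> g1 = g2)"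
    by (rule AE_unique_subgradient[OF _ cont]) (simp add: U_def)
  ultimately show ?thesis
  proof (eventually_elim, intro ballI)
    fix x y1 y2
    assume fr: "x \<notin> frontier D"
      and uniq: "x \<in> U \<longrightarrow> (\<forall>g1 g2. (\<forall>y\<in>U. f x + g1 \<bullet> (y - x) \<le> f y) \<longrightarrow> (\<forall>y\<in>U. f x + g2 \<bullet> (y - x) \<le> f y) \<longrightarrow> g1 = g2)"
      and y: "y1 \<in> polar_subdifferential \<phi> x" "y2 \<in> polar_subdifferential \<phi> x"
    note ineq = polar_subdifferential_inequality
    have "x \<in> D" using ineq(2)[OF y(1)] by (simp add: D_def)
    then have "x \<in> U" using fr closure_subset[of D] by (auto simp: frontier_def U_def)
    have sub: "\<forall>z\<in>U. f x + ((f x / (x \<bullet> y - 1)) *\<^sub>R y) \<bullet> (z - x) \<le> f z"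
      if y: "y \<in> polar_subdifferential \<phi> x" for y
    proof
      fix z assume "z \<in> U"
      then have "\<phi> z < \<infinity>" using interior_subset[of D] by (auto simp: U_def D_def)
      then have "f x * (z \<bullet> y - 1) \<le> (x \<bullet> y - 1) * f z" using ineq(4)[OF y] by (simp add: f_def)
      then have "f x * (z \<bullet> y - 1) / (x \<bullet> y - 1) \<le> f z" using ineq(1)[OF y] by (simp add: pos_divide_le_eq mult.commute)
      moreover have "f x + ((f x / (x \<bullet> y - 1)) *\<^sub>R y) \<bullet> (z - x) = f x * (z \<bullet> y - 1) / (x \<bullet> y - 1)"
      proof -
        define s where "s = x \<bullet> y - 1"
        have "s > 0" using ineq(1)[OF y] by (simp add: s_def)
        have "((f x / s) *\<^sub>R y) \<bullet> (z - x) = f x / s * ((z \<bullet> y - 1) - s)"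
        proof -
          have "y \<bullet> (z - x) = (z \<bullet> y - 1) - s" by (simp add: s_def inner_diff_right inner_commute[of y])
          then show ?thesis by simp
        qed
        also have "f x + \<dots> = f x * (z \<bullet> y - 1) / s"
          using \<open>s > 0\<close> by (simp add: field_simps)
        finally show ?thesis by (simp add: s_def)
      qed
      ultimately show "f x + ((f x / (x \<bullet> y - 1)) *\<^sub>R y) \<bullet> (z - x) \<le> f z" by simp
    qed
    have eq: "(f x / (x \<bullet> y1 - 1)) *\<^sub>R y1 = (f x / (x \<bullet> y2 - 1)) *\<^sub>R y2"
      using uniq \<open>x \<in> U\<close> sub[OF y(1)] sub[OF y(2)] by blast
    have fx: "f x > 0" using ineq(3)[OF y(1)] by (simp add: f_def)
    define s t where "s = x \<bullet> y1 - 1" and "t = x \<bullet> y2 - 1"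
    have st: "s > 0" "t > 0" using ineq(1)[OF y(1)] ineq(1)[OF y(2)] by (auto simp: s_def t_def)
    have "x \<bullet> ((f x / s) *\<^sub>R y1) = x \<bullet> ((f x / t) *\<^sub>R y2)" using eq by (simp add: s_def t_def)
    then have "f x / s * (s + 1) = f x / t * (t + 1)" by (simp add: s_def t_def)
    then have "s = t" using fx st by (simp add: field_simps)
    then show "y1 = y2" using eq fx st by (simp add: s_def t_def)
  qed
qed

section \<open>Connecting the support by paths\<close>

lemma convex_polar_set: "convex (polar_set K)"
  and closed_polar_set: "closed (polar_set K)"
proof -
  have eq: "polar_set K = (\<Inter>x\<in>K. {y. x \<bullet> y \<le> 1})" by (auto simp: polar_set_def)
  show "convex (polar_set K)" unfolding eq by (intro convex_INT convex_halfspace_le)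
  show "closed (polar_set K)" unfolding eq by (intro closed_INT ballI closed_halfspace_le)
qed

lemma subset_polar_polar: "K \<subseteq> polar_set (polar_set K)"
  by (auto simp: polar_set_def inner_commute)

text \<open>Let \<open>R\<close> be the set of points that can be reached from \<open>a\<close>, and
  \<open>K\<close> the polar of its second components. Strong compatibility makes
  \<open>R\<close> a null set or a set of full measure. It contains \<open>\<Gamma>\<close> near
  \<open>a\<close>, so it is not null, and hence it meets every neighbourhood of
  \<open>b\<close>; but all points near \<open>b\<close> have an edge to \<open>b\<close>.\<close>

lemma paths_connect_support:
  fixes \<mu> \<nu> :: "'a::euclidean_space measure"
  assumes compat: "strongly_polar_compatible \<mu> \<nu>" and plan: "transport_plan \<mu> \<nu> \<pi>"
    and \<Gamma>: "\<Gamma> = measure_support \<pi> \<inter> {a. gap a a > 0}" and AE_\<Gamma>: "AE a in \<pi>. a \<in> \<Gamma>"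
    and a: "a \<in> \<Gamma>" and b: "b \<in> \<Gamma>"
  shows "\<exists>w. path_weight \<Gamma> a b w"
proof -
  note bp = transport_planD[OF plan]
  interpret prob_space \<pi> using bp(1) by (rule borel_probD)
  have sets_\<pi>: "sets \<pi> = sets borel" and space_\<pi>: "space \<pi> = UNIV" using borel_probD[OF bp(1)] by auto
  define R where "R = {c\<in>\<Gamma>. \<exists>w. path_weight \<Gamma> a c w}"
  define K where "K = polar_set (snd ` R)"
  have R_iff: "fst c \<notin> K" if "c \<in> R" for c
  proof -
    have "gap c c > 0" using that by (auto simp: R_def \<Gamma>)
    then show ?thesis using that by (force simp: K_def polar_set_def gap_def inner_commute)
  qed
  have R_iff': "c \<in> R" if c: "c \<in> \<Gamma>" "fst c \<notin> K" for c
  proof -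
    obtain d where d: "d \<in> R" "gap d c > 0"
      using c(2) by (auto simp: K_def polar_set_def gap_def inner_commute not_le)
    then show ?thesis using path_weight.step[of \<Gamma> a d _ c] c(1) by (auto simp: R_def)
  qed
  have closed_K: "closed K" unfolding K_def by (rule closed_polar_set)
  have cont: "(fst :: 'a \<times> 'a \<Rightarrow> 'a) \<in> \<pi> \<rightarrow>\<^sub>M borel" "(snd :: 'a \<times> 'a \<Rightarrow> 'a) \<in> \<pi> \<rightarrow>\<^sub>M borel"
    using borel_measurable_continuous_onI[OF continuous_on_fst[OF continuous_on_id]]
      borel_measurable_continuous_onI[OF continuous_on_snd[OF continuous_on_id]] sets_\<pi>
    by (auto cong: measurable_cong_sets)
  define Q where "Q = {c :: 'a \<times> 'a. fst c \<in> K}"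
  have Q: "Q \<in> sets \<pi>"
    using measurable_sets[OF cont(1), of K] closed_K by (simp add: Q_def vimage_def space_\<pi> borel_closed)
  have \<mu>K: "measure \<mu> K = prob Q"
    unfolding bp(2)[symmetric] using closed_K by (subst measure_distr[OF cont(1)]) (auto simp: Q_def vimage_def space_\<pi> borel_closed)
  have \<nu>K: "1 - prob Q \<le> measure \<nu> (polar_set K)"
  proof -
    have "1 - prob Q = prob (space \<pi> - Q)" by (rule prob_compl[OF Q, symmetric])
    also have "\<dots> \<le> prob (snd -` polar_set K \<inter> space \<pi>)"
    proof (rule finite_measure_mono_AE)
      show "snd -` polar_set K \<inter> space \<pi> \<in> sets \<pi>"
        by (rule measurable_sets[OF cont(2)]) (simp add: closed_polar_set borel_closed)
      show "AE c in \<pi>. c \<in> space \<pi> - Q \<longrightarrow> c \<in> snd -` polar_set K \<inter> space \<pi>"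
        using AE_\<Gamma>
      proof eventually_elim
        fix c assume "c \<in> \<Gamma>"
        then show "c \<in> space \<pi> - Q \<longrightarrow> c \<in> snd -` polar_set K \<inter> space \<pi>"
          using R_iff'[of c] subset_polar_polar[of "snd ` R"] by (auto simp: Q_def K_def space_\<pi>)
      qed
    qed
    also have "\<dots> = measure \<nu> (polar_set K)"
      unfolding bp(3)[symmetric] by (subst measure_distr[OF cont(2)]) (auto simp: closed_polar_set borel_closed)
    finally show ?thesis .
  qed
  have K_\<mu>: "K \<in> sets \<mu>" using closed_K bp(2) by (auto simp: borel_closed)
  \<comment> \<open>The preimage \<open>Q\<close> of \<open>K\<close> and its complement together give \<open>\<mu>\<close> of \<open>K\<close> plus \<open>\<nu>\<close> of its polar at least the mass 1.\<close>
  have zero_one: "prob Q = 0 \<or> prob Q = 1"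
  proof (rule ccontr)
    assume "\<not> ?thesis"
    then have "measure (completion \<mu>) K \<noteq> 0" "measure (completion \<mu>) K \<noteq> 1"
      using \<mu>K by (simp_all add: measure_completion[OF K_\<mu>])
    moreover have "convex K" unfolding K_def by (rule convex_polar_set)
    ultimately have "measure (completion \<mu>) K + measure \<nu> (polar_set K) < 1"
      using compat unfolding strongly_polar_compatible_def by blast
    then show False using \<mu>K \<nu>K by (simp add: measure_completion[OF K_\<mu>])
  qed
  have nbhd: "emeasure \<pi> V > 0" if "open V" "c \<in> V" "c \<in> \<Gamma>" for V c
    using that by (auto simp: \<Gamma> measure_support_def)
  have null: "emeasure \<pi> V = 0" if "AE c in \<pi>. c \<notin> V" "V \<in> sets \<pi>" for V
    using that AE_iff_measurable[of V \<pi> "\<lambda>c. c \<notin> V"] by (simp add: space_\<pi>)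
  have a_pos: "gap a a > 0" "gap b b > 0" using a b by (auto simp: \<Gamma>)
  have "prob Q = 0"
  proof (rule ccontr)
    assume "\<not> ?thesis"
    then have "prob Q = 1" using zero_one by auto
    then have "AE c in \<pi>. c \<in> Q" using Q AE_in_set_eq_1 by blast
    then have "AE c in \<pi>. c \<notin> {c. gap a c > 0}"
      using AE_\<Gamma>
    proof eventually_elim
      fix c assume c: "c \<in> Q" "c \<in> \<Gamma>"
      show "c \<notin> {c. gap a c > 0}"
      proof
        assume "c \<in> {c. gap a c > 0}"
        then have "c \<in> R" using path_weight.step[OF path_weight.refl[OF a] c(2)] c(2) by (auto simp: R_def)
        then show False using R_iff c by (auto simp: Q_def)
      qed
    qed
    moreover have op: "open {c. gap a c > 0}"
      unfolding gap_def by (intro open_Collect_less continuous_intros)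
    ultimately show False using null nbhd[OF op, of a] a a_pos(1) sets_\<pi> by auto
  qed
  then have Q0: "AE c in \<pi>. c \<notin> Q" using Q by (intro AE_not_in) (simp add: emeasure_eq_measure null_setsI)
  have op: "open {c. gap c b > 0}"
    unfolding gap_def by (intro open_Collect_less continuous_intros)
  have "\<exists>c\<in>R. gap c b > 0"
  proof (rule ccontr)
    assume no: "\<not> ?thesis"
    have "AE c in \<pi>. c \<notin> {c. gap c b > 0}"
      using AE_\<Gamma> Q0
    proof eventually_elim
      fix c assume "c \<in> \<Gamma>" "c \<notin> Q"
      then show "c \<notin> {c. gap c b > 0}" using no R_iff'[of c] by (auto simp: Q_def)
    qed
    then show False using null nbhd[OF op, of b] b a_pos(2) sets_\<pi> op by auto
  qed
  then show ?thesis using path_weight.step[of \<Gamma> a _ _ b] b by (auto simp: R_def)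
qed

section \<open>The optimal map\<close>

text \<open>An open set is a countable union of compact sets, and projections of compact sets are compact.\<close>

lemma sets_borel_fst_image:
  fixes S G :: "('a::euclidean_space \<times> 'a) set"
  assumes "closed S" and "open G"
  shows "fst ` (S \<inter> G) \<in> sets borel"
proof -
  obtain C where C: "\<And>n. compact (C n)" "(\<Union>n::nat. C n) = G"
    using open_Union_compact_subsets[OF \<open>open G\<close>] by metis
  have "fst ` (S \<inter> G) = (\<Union>n. fst ` (S \<inter> C n))" using C(2) by auto
  moreover have "fst ` (S \<inter> C n) \<in> sets borel" for n
    using C(1) \<open>closed S\<close> by (intro borel_compact compact_continuous_image closed_Int_compact continuous_on_fst continuous_on_id)
  ultimately show ?thesis by (auto intro!: sets.countable_UN)
qed

text \<open>The map \<open>T\<close> sends almost every \<open>x\<close> to the only \<open>y\<close> with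
  \<open>(x, y) \<in> \<Gamma>\<close>. Since \<open>\<pi>\<close> is carried by
  \<open>\<Gamma>\<close>, it is the plan induced by \<open>T\<close>, and its optimality is
  that of \<open>\<pi>\<close>.\<close>

lemma polar_transport_map_exists:
  fixes \<mu> \<nu> :: "'a::euclidean_space measure"
  assumes \<mu>: "borel_prob \<mu>" and \<nu>: "borel_prob \<nu>"
    and mom: "finite_second_moment \<mu>" "finite_second_moment \<nu>"
    and compat: "strongly_polar_compatible \<mu> \<nu>"
    and ac: "absolutely_continuous lborel \<mu>"
    and fin: "finite_cost_plan \<mu> \<nu> \<pi>0"
  shows "\<exists>\<phi>\<in>Cvx0. optimal_transport_map \<mu> \<nu> (polar_subdifferential \<phi>)"
proof -
  obtain C where C: "\<And>\<pi>. transport_plan \<mu> \<nu> \<pi> \<Longrightarrow> plan_cost \<pi> = enn2ereal (shifted_plan_cost \<pi>) - ereal C"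
    using plan_cost_shift[OF mom] by blast
  have plan0: "transport_plan \<mu> \<nu> \<pi>0" using fin by (simp add: finite_cost_plan_def)
  obtain \<pi> where plan: "transport_plan \<mu> \<nu> \<pi>"
    and min: "\<And>\<pi>'. transport_plan \<mu> \<nu> \<pi>' \<Longrightarrow> shifted_plan_cost \<pi> \<le> shifted_plan_cost \<pi>'"
    using exists_minimal_plan[OF \<mu> \<nu> plan0] by blast
  have "shifted_plan_cost \<pi>0 \<noteq> \<infinity>"
    using fin C[OF plan0] by (auto simp: finite_cost_plan_def)
  then have fin_\<pi>: "shifted_plan_cost \<pi> < \<infinity>"
    using min[OF plan0] by (auto simp: less_top top_unique)
  note bp = transport_planD[OF plan]
  interpret \<pi>: prob_space \<pi> using bp(1) by (rule borel_probD)
  have sets_\<pi>: "sets \<pi> = sets borel" and space_\<pi>: "space \<pi> = UNIV" using borel_probD[OF bp(1)] by auto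
  have sets_\<mu>: "sets \<mu> = sets borel" using borel_probD[OF \<mu>] by auto
  have fst_m: "(fst :: 'a \<times> 'a \<Rightarrow> 'a) \<in> \<pi> \<rightarrow>\<^sub>M borel" and snd_m: "(snd :: 'a \<times> 'a \<Rightarrow> 'a) \<in> \<pi> \<rightarrow>\<^sub>M borel"
    using borel_measurable_continuous_onI[OF continuous_on_fst[OF continuous_on_id]]
      borel_measurable_continuous_onI[OF continuous_on_snd[OF continuous_on_id]] sets_\<pi>
    by (auto cong: measurable_cong_sets)
  define \<Gamma> where "\<Gamma> = measure_support \<pi> \<inter> {a. gap a a > 0}"
  have gap: "gap a a > 0" if "a \<in> \<Gamma>" for a using that by (simp add: \<Gamma>_def)
  have AE_\<Gamma>: "AE a in \<pi>. a \<in> \<Gamma>"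
  proof -
    have "AE a in \<pi>. shifted_cost a \<noteq> \<infinity>"
      using measurable_shifted_cost sets_\<pi> fin_\<pi> unfolding shifted_plan_cost_def
      by (intro nn_integral_PInf_AE) (auto cong: measurable_cong_sets)
    with AE_measure_support[OF sets_\<pi>] show ?thesis
    proof eventually_elim
      fix a assume "a \<in> measure_support \<pi>" "shifted_cost a \<noteq> \<infinity>"
      then show "a \<in> \<Gamma>" using shifted_cost_eq_top[of "fst a" "snd a"] by (auto simp: \<Gamma>_def gap_def)
    qed
  qed
  have cyc: "polar_cyclically_monotone \<Gamma>"
    unfolding polar_cyclically_monotone_def
  proof (intro allI impI)
    fix N \<sigma> and z :: "nat \<Rightarrow> 'a \<times> 'a"
    assume \<sigma>: "bij_betw \<sigma> {..<N} {..<N}" and z: "\<forall>i<N. z i \<in> \<Gamma>"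
    show "(\<Sum>i<N. shifted_cost (z i)) \<le> (\<Sum>i<N. shifted_cost (fst (z (\<sigma> i)), snd (z i)))"
    proof (cases "N > 0")
      case True
      show ?thesis
        by (rule cyclical_monotonicity[OF bp(1) \<sigma> True plan min fin_\<pi>]) (use z in \<open>auto simp: \<Gamma>_def\<close>)
    qed simp
  qed
  have conn: "\<exists>w. path_weight \<Gamma> a b w" if "a \<in> \<Gamma>" "b \<in> \<Gamma>" for a b
    by (rule paths_connect_support[OF compat plan \<Gamma>_def AE_\<Gamma> that])
  obtain a0 where a0: "a0 \<in> \<Gamma>"
    using AE_\<Gamma> \<pi>.AE_False by (metis (no_types, lifting) eventually_mono)
  define \<phi> where "\<phi> = potential \<Gamma> a0"
  have \<phi>: "\<phi> \<in> Cvx0"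
    unfolding \<phi>_def by (rule potential_Cvx0[OF gap cyc conn a0])
  have sub: "snd b \<in> polar_subdifferential \<phi> (fst b)" if "b \<in> \<Gamma>" for b
    unfolding \<phi>_def by (rule potential_polar_subdifferential[OF gap cyc conn a0 that])
  from AE_polar_subdifferential_unique[OF \<phi>]
  obtain N where N: "N \<in> null_sets lborel" and uniq:
    "\<And>x y1 y2. x \<notin> N \<Longrightarrow> y1 \<in> polar_subdifferential \<phi> x \<Longrightarrow> y2 \<in> polar_subdifferential \<phi> x \<Longrightarrow> y1 = y2"
    by (auto elim!: AE_E3)
  have N_\<mu>: "N \<in> null_sets \<mu>" using ac N by (auto simp: absolutely_continuous_def)
  have N_borel: "N \<in> sets borel" using N by auto
  define P where "P = fst ` \<Gamma> - N"
  define T where "T x = (if x \<in> P then SOME y. (x, y) \<in> \<Gamma> else 0)" for x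
  have T_graph: "(x, T x) \<in> \<Gamma>" if "x \<in> P" for x
  proof -
    have "\<exists>y. (x, y) \<in> \<Gamma>" using that by (force simp: P_def)
    then show ?thesis using that by (auto simp: T_def intro: someI_ex)
  qed
  have T_eq: "y = T x" if "(x, y) \<in> \<Gamma>" "x \<notin> N" for x y
  proof -
    have "x \<in> P" using that by (force simp: P_def)
    then show ?thesis using uniq[OF that(2), of y "T x"] sub[OF that(1)] sub[OF T_graph] by auto
  qed
  have op: "open {a :: 'a \<times> 'a. gap a a > 0}"
    unfolding gap_def by (intro open_Collect_less continuous_intros)
  have T_borel: "T \<in> borel_measurable borel"
  proof (rule borel_measurableI)
    fix S :: "'a set" assume S: "open S"
    have borel_image: "fst ` (\<Gamma> \<inter> {a. snd a \<in> V}) \<in> sets borel" if "open V" for V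
    proof -
      have "open (snd -` V :: ('a \<times> 'a) set)" using that by (rule open_vimage_snd)
      then have "open ({a. gap a a > 0} \<inter> {a :: 'a \<times> 'a. snd a \<in> V})" using op by (auto simp: vimage_def)
      then show ?thesis unfolding \<Gamma>_def Int_assoc by (rule sets_borel_fst_image[OF closed_measure_support])
    qed
    have P: "P \<in> sets borel" using borel_image[of UNIV] N_borel by (simp add: P_def)
    have "T -` S \<inter> space borel = (fst ` (\<Gamma> \<inter> {a. snd a \<in> S}) - N) \<union> (if 0 \<in> S then - P else {})"
    proof (intro set_eqI)
      fix x
      show "x \<in> T -` S \<inter> space borel \<longleftrightarrow> x \<in> (fst ` (\<Gamma> \<inter> {a. snd a \<in> S}) - N) \<union> (if 0 \<in> S then - P else {})"
      proof (cases "x \<in> P")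
        case True
        then have "x \<notin> N" by (simp add: P_def)
        have "T x \<in> S \<longleftrightarrow> x \<in> fst ` (\<Gamma> \<inter> {a. snd a \<in> S})"
        proof
          assume "T x \<in> S"
          then show "x \<in> fst ` (\<Gamma> \<inter> {a. snd a \<in> S})"
            using T_graph[OF True] by (intro image_eqI[of x fst "(x, T x)"]) auto
        next
          assume "x \<in> fst ` (\<Gamma> \<inter> {a. snd a \<in> S})"
          then obtain y where "(x, y) \<in> \<Gamma>" "y \<in> S" by auto
          then show "T x \<in> S" using T_eq[of x y] \<open>x \<notin> N\<close> by simp
        qed
        then show ?thesis using True \<open>x \<notin> N\<close> by simp
      next
        case False
        then have "T x = 0" by (simp add: T_def)
        moreover have "x \<notin> fst ` (\<Gamma> \<inter> {a. snd a \<in> S}) - N" using False by (auto simp: P_def)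
        ultimately show ?thesis using False by simp
      qed
    qed
    then show "T -` S \<inter> space borel \<in> sets borel"
      using borel_image[OF S] N_borel P by (auto simp: borel_comp)
  qed
  have AE_T: "AE a in \<pi>. snd a = T (fst a) \<and> fst a \<in> P"
  proof -
    have "AE x in distr \<pi> borel fst. x \<notin> N" unfolding bp(2) by (rule AE_not_in[OF N_\<mu>])
    then have "AE a in \<pi>. fst a \<notin> N" by (rule AE_distrD[OF fst_m])
    with AE_\<Gamma> show ?thesis
    proof eventually_elim
      fix a assume a: "a \<in> \<Gamma>" "fst a \<notin> N"
      then show "snd a = T (fst a) \<and> fst a \<in> P" using T_eq[of "fst a" "snd a"] by (auto simp: P_def)
    qed
  qed
  have graph_m: "(\<lambda>x. (x, T x)) \<in> borel \<rightarrow>\<^sub>M borel"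
    using T_borel by (subst borel_prod[symmetric]) measurable
  have graph: "distr \<mu> borel (\<lambda>x. (x, T x)) = \<pi>"
  proof -
    have "distr \<mu> borel (\<lambda>x. (x, T x)) = distr \<pi> borel ((\<lambda>x. (x, T x)) \<circ> fst)"
      unfolding bp(2)[symmetric] by (rule distr_distr[OF graph_m fst_m])
    also have "\<dots> = distr \<pi> borel (\<lambda>a. a)"
    proof (intro distr_cong_AE refl)
      show "AE a in \<pi>. ((\<lambda>x. (x, T x)) \<circ> fst) a = a" using AE_T by eventually_elim (simp add: prod_eq_iff)
    qed (use fst_m graph_m sets_\<pi> in \<open>auto intro: measurable_comp measurable_ident_sets\<close>)
    also have "\<dots> = \<pi>" by (rule distr_id2) (simp add: sets_\<pi>)
    finally show ?thesis .
  qed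
  have map: "transport_map \<mu> \<nu> T"
  proof -
    have "distr \<mu> borel T = distr \<pi> borel (T \<circ> fst)"
      unfolding bp(2)[symmetric] by (rule distr_distr[OF T_borel fst_m])
    also have "\<dots> = distr \<pi> borel snd"
    proof (intro distr_cong_AE refl)
      show "AE a in \<pi>. (T \<circ> fst) a = snd a" using AE_T by eventually_elim simp
    qed (use fst_m T_borel snd_m in \<open>auto intro: measurable_comp\<close>)
    finally show ?thesis using T_borel sets_\<mu> bp(3) by (simp add: transport_map_def cong: measurable_cong_sets)
  qed
  have "AE x in \<mu>. x \<in> P"
  proof -
    have "P \<in> sets borel"
      using sets_borel_fst_image[OF closed_measure_support op] N_borel by (auto simp: P_def \<Gamma>_def)
    then have "AE x in distr \<pi> borel fst. x \<in> P"
      using AE_T by (subst AE_distr_iff[OF fst_m]) (auto elim: eventually_mono)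
    then show ?thesis unfolding bp(2) .
  qed
  then have single: "AE x in \<mu>. polar_subdifferential \<phi> x = {T x}"
  proof eventually_elim
    fix x assume x: "x \<in> P"
    have "T x \<in> polar_subdifferential \<phi> x" using sub[OF T_graph[OF x]] by simp
    moreover have "x \<notin> N" using x by (simp add: P_def)
    ultimately show "polar_subdifferential \<phi> x = {T x}" using uniq by blast
  qed
  have "optimal_plan \<mu> \<nu> \<pi>"
    unfolding optimal_plan_def
  proof (intro conjI allI impI plan)
    fix \<pi>' assume \<pi>': "transport_plan \<mu> \<nu> \<pi>'"
    show "plan_cost \<pi> \<le> plan_cost \<pi>'"
      unfolding C[OF plan] C[OF \<pi>'] using min[OF \<pi>'] by (intro ereal_minus_mono) (auto simp: less_eq_ennreal.rep_eq)
  qed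
  then have "optimal_transport_map \<mu> \<nu> (polar_subdifferential \<phi>)"
    unfolding optimal_transport_map_def using map single graph by auto
  then show ?thesis using \<phi> by blast
qed

theorem theorem1p2:
  fixes \<mu> \<nu> :: "(real ^ 'n) measure"
  assumes "borel_prob \<mu>" and "borel_prob \<nu>"
    and "finite_second_moment \<mu>" and "finite_second_moment \<nu>"
    and "strongly_polar_compatible \<mu> \<nu>"
    and "absolutely_continuous lborel \<mu>"
    and "\<exists>\<pi>. finite_cost_plan \<mu> \<nu> \<pi>"
  shows "\<exists>\<phi>\<in>Cvx0. optimal_transport_map \<mu> \<nu> (polar_subdifferential \<phi>) \<and>
           (AE x in \<mu>. is_singleton (polar_subdifferential \<phi> x))"
proof -
  obtain \<phi> where \<phi>: "\<phi> \<in> Cvx0" and opt: "optimal_transport_map \<mu> \<nu> (polar_subdifferential \<phi>)"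
    using polar_transport_map_exists[OF assms(1-6)] assms(7) by blast
  from opt obtain T where "AE x in \<mu>. polar_subdifferential \<phi> x = {T x}"
    by (auto simp: optimal_transport_map_def)
  then have "AE x in \<mu>. is_singleton (polar_subdifferential \<phi> x)"
    by eventually_elim simp
  with \<phi> opt show ?thesis by blast
qed

end
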